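(* Let $\mathcal H$ be a finite-dimensional real Hilbert space, let $S^-,S^+\subset\mathcal H$ be disjoint nonempty compact subsets, and set $D:=d(S^-,S^+)>0$ and $\rho(q):=\min\{d(q,S^-),d(q,S^+)\}$ for $q\in\mathcal H$. Let $W:\mathcal H\to[0,\infty)$ be continuous, and let $g:[0,D/2)\to[0,\infty)$ be Borel measurable and locally bounded. Suppose that $$W(q)\ge g(\rho(q))\qquad\text{whenever }\rho(q)<D/2 .$$ Then every $\Psi\in H^1_{\mathrm{loc}}(\mathbb R;\mathcal H)$ with finite energy and with limits $\Psi(-\infty)\in S^-$ and $\Psi(+\infty)\in S^+$ satisfies $$\int_{\mathbb R}\bigl(\lVert\Psi'\rVert^2+W(\Psi)\bigr)\,dz\ \ge\ 4\int_0^{D/2}\sqrt{g(s)}\,ds .$$ Equality holds if, in addition, $$W(\Psi)=g(\rho(\Psi))\quad\text{for a.e. }z\text{ with }\rho(\Psi(z))<D/2,$$ $$\lVert\Psi'\rVert^2=W(\Psi),\qquad |(\rho\circ\Psi)'|=\lVert\Psi'\rVert\qquad\text{a.e.},$$ and $\rho\circ\Psi$ increases from $0$ to $D/2$ and then decreases to $0$ (as $z$ runs from $-\infty$ to $+\infty$), with its $D/2$-level set $\{z:\rho(\Psi(z))=D/2\}$ of measure zero.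
   Context: For a nonempty compact set $S\subset\mathcal H$, $d(q,S)=\min_{p\in S}\lVert q-p\rVert$, and $d(S^-,S^+)=\min_{p\in S^-,q\in S^+}\lVert p-q\rVert$. The energy of $\Psi$ is $\int_{\mathbb R}(\lVert\Psi'\rVert^2+W(\Psi))\,dz$, and finite energy means that this quantity is finite. $\Psi(\pm\infty)$ denotes $\lim_{z\to\pm\infty}\Psi(z)$ (of the continuous representative). *)

theory Defs
  imports "HOL-Analysis.Analysis"
begin

definition test_fun :: "(real \<Rightarrow> real) \<Rightarrow> bool" where
  "test_fun \<phi> \<longleftrightarrow>
     (\<forall>n x. (deriv ^^ n) \<phi> field_differentiable (at x)) \<and> compact (closure {x. \<phi> x \<noteq> 0})"

definition L1_loc :: "(real \<Rightarrow> 'a::euclidean_space) set" where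
  "L1_loc = {u. u \<in> borel_measurable lebesgue \<and>
     (\<forall>K. compact K \<longrightarrow> set_integrable lebesgue K u)}"

definition L2_loc :: "(real \<Rightarrow> 'a::euclidean_space) set" where
  "L2_loc = {u. u \<in> borel_measurable lebesgue \<and>
     (\<forall>K. compact K \<longrightarrow> set_integrable lebesgue K (\<lambda>x. (norm (u x))\<^sup>2))}"

definition has_weak_deriv ::
  "(real \<Rightarrow> 'a::euclidean_space) \<Rightarrow> (real \<Rightarrow> 'a) \<Rightarrow> bool" where
  "has_weak_deriv u v \<longleftrightarrow> u \<in> L1_loc \<and> v \<in> L1_loc \<and>
     (\<forall>\<phi>. test_fun \<phi> \<longrightarrow>
        (\<integral>x. deriv \<phi> x *\<^sub>R u x \<partial>lebesgue) = - (\<integral>x. \<phi> x *\<^sub>R v x \<partial>lebesgue))"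

definition H1_loc :: "(real \<Rightarrow> 'a::euclidean_space) set" where
  "H1_loc = {u. u \<in> L2_loc \<and> (\<exists>v. v \<in> L2_loc \<and> has_weak_deriv u v)}"

(* Elements of the function spaces above are functions, not classes modulo equality a.e.;
   pointwise statements about u therefore go through its unique continuous representative,
   which exists for every u in H1_loc. *)
definition cont_rep :: "(real \<Rightarrow> 'a::euclidean_space) \<Rightarrow> real \<Rightarrow> 'a" where
  "cont_rep u = (THE w. continuous_on UNIV w \<and> (AE z in lebesgue. w z = u z))"

(* The argument v stands for the weak derivative of u. *)
definition energy ::
  "('a::euclidean_space \<Rightarrow> real) \<Rightarrow> (real \<Rightarrow> 'a) \<Rightarrow> (real \<Rightarrow> 'a) \<Rightarrow> ennreal" where
  "energy W u v = (\<integral>\<^sup>+z. ennreal ((norm (v z))\<^sup>2 + W (u z)) \<partial>lebesgue)"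

end

(* The coarea form of the Modica-Mortola argument. Pointwise,
   |Psi'|^2 + W(Psi) >= 2 sqrt(g(R)) |Psi'| on {R < D/2} for R = rho o Psi, and R is controlled by
   |R(y) - R(x)| <= integral of |Psi'| over [x,y]. Hence the image of |Psi'| dz under R dominates
   Lebesgue measure on every open interval that R crosses, and by outer regularity on every Borel set.
   Since R runs from 0 to at least D/2 (at a point equidistant from both wells) and back,
   (0,D/2) is covered twice, which gives the factor 4. If R is monotone on both branches and
   |R'| = |Psi'|, the reverse domination holds by the same comparison of measures on intervals.
   The continuous representative comes from the du Bois-Reymond lemma, proved with the test functions
   exp(-k/(x-a)) exp(-k/(b-x)), which tend to the indicator of (a,b) as k -> 0. *)
theory Submission
  imports Defs "HOL-Computational_Algebra.Polynomial"
begin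

text \<open>The obstacle is regularity. With \<open>H' = sqrt g\<close> one would like to
  differentiate \<open>H (R z)\<close>, but \<open>g\<close> is only Borel and \<open>\<rho>\<close>
  only Lipschitz, so the chain rule is delicate where \<open>R\<close> meets exceptional sets.
  Comparing image measures asks only for bounds on increments over intervals and yields a change of
  variables for every Borel \<open>G\<close>. The same comparison stands in for differentiation of
  integrals: if all integrals over intervals are nonnegative, the negative part is dominated by the
  positive part and must vanish. This serves both the du Bois-Reymond lemma and the sign of
  \<open>R'\<close> on a monotone branch. Outer regularity asks for a finite dominating measure, so
  crossings are taken on compact intervals. Since \<open>R\<close> may approach 0 only in the limit,
  the bands are \<open>(\<epsilon>, D/2)\<close> with \<open>\<epsilon> > 0\<close>, and monotone
  convergence removes \<open>\<epsilon>\<close> at the end.\<close>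

section \<open>Comparison of measures on the line and crossings\<close>

lemma bounded_open_connected_real:
  fixes C :: "real set"
  assumes "open C" "connected C" "bounded C" "C \<noteq> {}"
  obtains a b where "a < b" "C = {a<..<b}"
proof
  have bdd: "bdd_above C" "bdd_below C"
    using bounded_imp_bdd_above[OF assms(3)] bounded_imp_bdd_below[OF assms(3)] .
  have lt: "Inf C < x \<and> x < Sup C" if x: "x \<in> C" for x
  proof -
    obtain e where e: "e > 0" "\<And>y. dist y x < e \<Longrightarrow> y \<in> C"
      using \<open>open C\<close> x unfolding open_dist by blast
    have "x - e/2 \<in> C" "x + e/2 \<in> C" using e by (auto simp: dist_real_def)
    then have "Inf C \<le> x - e/2" "x + e/2 \<le> Sup C"
      using cInf_lower[OF _ bdd(2)] cSup_upper[OF _ bdd(1)] by blast+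
    with e show ?thesis by linarith
  qed
  obtain x where "x \<in> C" using assms(4) by blast
  from lt[OF this] show "Inf C < Sup C" by linarith
  show "C = {Inf C<..<Sup C}"
  proof (intro set_eqI iffI)
    fix x assume "x \<in> {Inf C<..<Sup C}"
    then obtain y z where "y \<in> C" "y < x" "z \<in> C" "x < z"
      using cInf_less_iff[OF assms(4) bdd(2), of x] less_cSup_iff[OF assms(4) bdd(1), of x] by auto
    with connected_contains_Icc[OF \<open>connected C\<close> this(1,3)] show "x \<in> C"
      by (simp add: subset_iff)
  qed (use lt in auto)
qed

text \<open>A bounded open set is the countable disjoint union of its components, which are bounded
  open intervals; exhaustion by \<open>(-n, n)\<close> covers all open sets, and then
  \<open>emeasure M B \<le> emeasure M U \<le> emeasure N U\<close> for every open \<open>U\<close>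
  containing \<open>B\<close>. Finiteness of \<open>N\<close> is what outer regularity asks for;
  that of \<open>M\<close> follows.\<close>

lemma measure_le_if_le_on_intervals:
  fixes M N :: "real measure"
  assumes sM[simp]: "sets M = sets borel" and sN[simp]: "sets N = sets borel"
    and fin: "emeasure N (space N) \<noteq> \<infinity>"
    and le: "\<And>a b. a < b \<Longrightarrow> emeasure M {a<..<b} \<le> emeasure N {a<..<b}"
  shows "M \<le> N"
proof -
  have bounded_le: "emeasure M U \<le> emeasure N U" if U: "open U" "bounded U" for U
  proof -
    have op: "open C" if "C \<in> components U" for C
      using that U(1) open_components by blast
    have cnt: "countable (components U)"
      by (rule countable_disjoint_open_subsets)
        (use op pairwise_disjoint_components[of U] in \<open>auto simp: pairwise_def disjnt_def\<close>)
    have dis: "disjoint_family_on (\<lambda>C. C) (components U)"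
      using pairwise_disjoint_components[of U] by (auto simp: pairwise_def disjoint_family_on_def)
    have C_le: "emeasure M C \<le> emeasure N C" if C: "C \<in> components U" for C
    proof -
      have "bounded C" using U(2) in_components_subset[OF C] bounded_subset by blast
      then obtain a b where "a < b" "C = {a<..<b}"
        using bounded_open_connected_real[of C] op[OF C] in_components_connected[OF C]
          in_components_nonempty[OF C] by metis
      then show ?thesis using le by simp
    qed
    have eq: "emeasure K U = (\<integral>\<^sup>+C. emeasure K C \<partial>count_space (components U))"
      if "sets K = sets borel" for K
      using emeasure_UN_countable[OF _ cnt dis, of K] op that by simp
    show ?thesis
      unfolding eq[OF sM] eq[OF sN] by (rule nn_integral_mono) (use C_le in simp)
  qed
  have open_le: "emeasure M U \<le> emeasure N U" if U: "open U" for U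
  proof -
    let ?V = "\<lambda>n. U \<inter> {- real n<..<real n}"
    have inc: "incseq ?V" by (auto simp: incseq_def)
    have UV: "(\<Union>n. ?V n) = U"
    proof (intro equalityI subsetI)
      fix x assume "x \<in> U"
      obtain n where "\<bar>x\<bar> < real n" using reals_Archimedean2 by blast
      with \<open>x \<in> U\<close> show "x \<in> (\<Union>n. ?V n)" by (auto intro!: exI[of _ n])
    qed auto
    have bor: "?V n \<in> sets borel" for n using U by auto
    have "emeasure M U = (SUP n. emeasure M (?V n))"
      using SUP_emeasure_incseq[of ?V M, OF _ inc] UV bor by (simp add: image_subset_iff)
    also have "\<dots> \<le> (SUP n. emeasure N (?V n))"
      by (intro SUP_mono' bounded_le) (use U in \<open>auto intro: bounded_Int\<close>)
    also have "\<dots> = emeasure N U"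
      using SUP_emeasure_incseq[of ?V N, OF _ inc] UV bor by (simp add: image_subset_iff)
    finally show ?thesis .
  qed
  have "emeasure M B \<le> emeasure N B" for B
  proof (cases "B \<in> sets borel")
    case True
    have "emeasure M B \<le> emeasure N U" if "B \<subseteq> U" "open U" for U
      using emeasure_mono[OF that(1), of M] open_le[OF that(2)] that by (auto intro: order_trans)
    then show ?thesis
      unfolding outer_regular[OF sN fin True] by (auto intro!: INF_greatest)
  \<comment> \<open>Outside the sigma-algebra \<open>emeasure\<close> has the default value
    0.\<close>
  qed (simp add: emeasure_notin_sets)
  then show ?thesis
    using sets_eq_imp_space_eq[OF sM] sets_eq_imp_space_eq[OF sN] by (simp add: le_measure_iff le_fun_def)
qed

section \<open>Crossings of a band by a continuous function\<close>

text \<open>\<open>c\<close> is the last visit to level \<open>s\<close> and \<open>d\<close> the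
  first visit to \<open>t\<close> after \<open>c\<close>. Leaving the band in between would, by the
  intermediate value theorem, produce a later visit to \<open>s\<close> or an earlier visit to
  \<open>t\<close>.\<close>

lemma continuous_crossing_up:
  fixes R :: "real \<Rightarrow> real"
  assumes cont: "continuous_on {a..b} R" and "a \<le> b" "R a \<le> s" "s < t" "t \<le> R b"
  obtains c d where "a \<le> c" "c < d" "d \<le> b" "R c = s" "R d = t"
    "\<And>z. c < z \<Longrightarrow> z < d \<Longrightarrow> s < R z \<and> R z < t"
proof -
  define S where "S = {a..b} \<inter> R -` {s}"
  obtain x0 where "x0 \<in> S"
    using IVT'[of R a s b] assms by (auto simp: S_def)
  have "compact S" unfolding S_def
    using continuous_closed_preimage[OF cont, of "{s}"] by (auto simp: compact_eq_bounded_closed bounded_Int)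
  then obtain c where c: "c \<in> S" "\<And>x. x \<in> S \<Longrightarrow> x \<le> c"
    using compact_attains_sup[of S] \<open>x0 \<in> S\<close> by blast
  have cab: "a \<le> c" "c \<le> b" "R c = s" using c(1) by (auto simp: S_def)
  define T where "T = {c..b} \<inter> R -` {t}"
  have contc: "continuous_on {c..b} R" using cont by (rule continuous_on_subset) (use cab in auto)
  obtain y0 where "y0 \<in> T"
    using IVT'[of R c t b] assms cab contc by (auto simp: T_def)
  have "compact T" unfolding T_def
    using continuous_closed_preimage[OF contc, of "{t}"] by (auto simp: compact_eq_bounded_closed bounded_Int)
  then obtain d where d: "d \<in> T" "\<And>x. x \<in> T \<Longrightarrow> d \<le> x"
    using compact_attains_inf[of T] \<open>y0 \<in> T\<close> by blast
  have dcb: "c \<le> d" "d \<le> b" "R d = t" using d(1) by (auto simp: T_def)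
  have "c < d" using dcb cab \<open>s < t\<close> by (cases "c = d") auto
  moreover have "s < R z \<and> R z < t" if "c < z" "z < d" for z
  proof (intro conjI; rule ccontr)
    assume "\<not> s < R z"
    moreover have "continuous_on {z..b} R"
      by (rule continuous_on_subset[OF contc]) (use that in auto)
    ultimately have "\<exists>x\<ge>z. x \<le> b \<and> R x = s"
      by (intro IVT') (use assms(4,5) dcb(2) that in auto)
    then obtain x where "z \<le> x" "x \<le> b" "R x = s" by blast
    then show False using c(2)[of x] that cab by (auto simp: S_def)
  next
    assume "\<not> R z < t"
    moreover have "continuous_on {c..z} R"
      by (rule continuous_on_subset[OF contc]) (use that dcb in auto)
    ultimately have "\<exists>x\<ge>c. x \<le> z \<and> R x = t"
      by (intro IVT') (use assms(4) cab(3) that in auto)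
    then obtain x where "c \<le> x" "x \<le> z" "R x = t" by blast
    then show False using d(2)[of x] that dcb by (auto simp: T_def)
  qed
  ultimately show ?thesis using that[of c d] cab dcb by simp
qed

lemma continuous_crossing:
  fixes R :: "real \<Rightarrow> real"
  assumes cont: "continuous_on {a..b} R" and "a \<le> b" "s < t"
    and "min (R a) (R b) \<le> s" "t \<le> max (R a) (R b)"
  obtains c d where "a \<le> c" "c < d" "d \<le> b" "\<bar>R d - R c\<bar> = t - s"
    "\<And>z. c < z \<Longrightarrow> z < d \<Longrightarrow> s < R z \<and> R z < t"
proof (cases "R a \<le> s")
  case True
  then have "t \<le> R b" using assms by auto
  then obtain c d where "a \<le> c" "c < d" "d \<le> b" "R c = s" "R d = t"
    "\<And>z. c < z \<Longrightarrow> z < d \<Longrightarrow> s < R z \<and> R z < t"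
    by (rule continuous_crossing_up[OF cont \<open>a \<le> b\<close> True \<open>s < t\<close>]) (rule that)
  then show ?thesis using that[of c d] \<open>s < t\<close> by simp
next
  case False
  \<comment> \<open>A downward crossing becomes an upward one under the reflection
    \<open>z \<mapsto> -z\<close>.\<close>
  have cont': "continuous_on {-b..-a} (\<lambda>z. R (- z))"
    by (rule continuous_on_compose2[OF cont]) (auto intro!: continuous_intros)
  have "R b \<le> s" "t \<le> R a" using False assms by auto
  then obtain c d where cd: "-b \<le> c" "c < d" "d \<le> -a" "R (-c) = s" "R (-d) = t"
    "\<And>z. c < z \<Longrightarrow> z < d \<Longrightarrow> s < R (-z) \<and> R (-z) < t"
    by (rule continuous_crossing_up[OF cont', of s t, unfolded minus_minus neg_le_iff_le,
          OF \<open>a \<le> b\<close> _ \<open>s < t\<close>]) (rule that)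
  show ?thesis
  proof (rule that[of "-d" "-c"])
    show "s < R z \<and> R z < t" if "-d < z" "z < -c" for z using cd(6)[of "-z"] that by auto
  qed (use cd assms in auto)
qed

section \<open>One-sided change of variables by comparison of image measures\<close>

lemma nn_integral_zero:
  assumes "\<And>x. x \<in> space M \<Longrightarrow> f x = 0"
  shows "(\<integral>\<^sup>+x. f x \<partial>M) = 0"
  using nn_integral_cong[of M f "\<lambda>_. 0"] assms by simp

text \<open>Lower half of the coarea comparison: the image under \<open>R\<close> of the measure
  \<open>m dz\<close> on \<open>[a,b]\<close> dominates Lebesgue measure on the band. For an
  interval inside the band one crossing suffices, since its height is at most the mass of
  \<open>m\<close> along it; further crossings are discarded.\<close>

lemma nn_integral_le_crossing:
  fixes R :: "real \<Rightarrow> real" and m G :: "real \<Rightarrow> ennreal"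
  assumes R: "continuous_on UNIV R" and m[measurable]: "m \<in> borel_measurable borel"
    and G[measurable]: "G \<in> borel_measurable borel"
    and "a \<le> b" and fin: "(\<integral>\<^sup>+z\<in>{a..b}. m z \<partial>lborel) < \<infinity>"
    and var: "\<And>x y. a \<le> x \<Longrightarrow> x \<le> y \<Longrightarrow> y \<le> b \<Longrightarrow> ennreal \<bar>R y - R x\<bar> \<le> (\<integral>\<^sup>+z\<in>{x..y}. m z \<partial>lborel)"
    and ends: "min (R a) (R b) \<le> \<alpha>" "\<beta> \<le> max (R a) (R b)"
  shows "(\<integral>\<^sup>+s\<in>{\<alpha><..<\<beta>}. G s \<partial>lborel)
    \<le> (\<integral>\<^sup>+z\<in>{a..b}. (G (R z) * indicator {\<alpha><..<\<beta>} (R z)) * m z \<partial>lborel)"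
proof -
  have R'[measurable]: "R \<in> borel_measurable borel"
    using R by (rule borel_measurable_continuous_onI)
  define M where "M = density lborel (indicator {\<alpha><..<\<beta>} :: real \<Rightarrow> ennreal)"
  define N where "N = distr (density lborel (\<lambda>z. m z * indicator {a..b} z)) borel R"
  have N: "emeasure N X = (\<integral>\<^sup>+z. m z * indicator {a..b} z * indicator (R -` X) z \<partial>lborel)"
    if X: "X \<in> sets borel" for X
  proof -
    have "R -` X \<in> sets borel" using measurable_sets_borel[OF R' X] by simp
    then show ?thesis unfolding N_def using X by (simp add: emeasure_distr emeasure_density)
  qed
  have "M \<le> N"
  proof (rule measure_le_if_le_on_intervals)
    show "emeasure N (space N) \<noteq> \<infinity>"
      using fin N[of UNIV] by (simp add: N_def less_top)
  next
    fix s t :: real assume "s < t"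
    let ?s = "max \<alpha> s" and ?t = "min \<beta> t"
    have "{\<alpha><..<\<beta>} \<inter> {s<..<t} = {?s<..<?t}" by auto
    then have M: "emeasure M {s<..<t} = emeasure lborel {?s<..<?t}"
      by (simp add: M_def emeasure_density indicator_inter_arith[symmetric])
    show "emeasure M {s<..<t} \<le> emeasure N {s<..<t}"
    proof (cases "?s < ?t")
      case True
      obtain c d where cd: "a \<le> c" "c < d" "d \<le> b" "\<bar>R d - R c\<bar> = ?t - ?s"
        "\<And>z. c < z \<Longrightarrow> z < d \<Longrightarrow> ?s < R z \<and> R z < ?t"
        by (rule continuous_crossing[of a b R ?s ?t])
          (use R True ends \<open>a \<le> b\<close> in \<open>auto intro: continuous_on_subset\<close>)
      have "emeasure M {s<..<t} = ennreal \<bar>R d - R c\<bar>" using True M cd(4) by simp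
      also have "\<dots> \<le> (\<integral>\<^sup>+z\<in>{c..d}. m z \<partial>lborel)" using cd by (intro var) auto
      \<comment> \<open>The endpoints go because \<open>R\<close> takes the extreme values
        \<open>?s\<close> and \<open>?t\<close> there, which may lie outside
        \<open>(s,t)\<close>.\<close>
      also have "\<dots> = (\<integral>\<^sup>+z\<in>{c<..<d}. m z \<partial>lborel)"
        by (intro nn_integral_cong_AE)
          (use AE_lborel_singleton[of c] AE_lborel_singleton[of d] in
            \<open>eventually_elim, auto simp: indicator_def\<close>)
      also have "\<dots> \<le> (\<integral>\<^sup>+z. m z * indicator {a..b} z * indicator (R -` {s<..<t}) z \<partial>lborel)"
        by (intro nn_integral_mono) (use cd in \<open>auto simp: indicator_def\<close>)
      finally show ?thesis by (simp add: N)
    next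
      case False
      then have "{?s<..<?t} = {}" by (simp only: greaterThanLessThan_empty_iff not_less)
      with M show ?thesis by (metis emeasure_empty zero_le)
    qed
  qed (simp_all add: M_def N_def)
  then have "(\<integral>\<^sup>+s. G s * indicator {\<alpha><..<\<beta>} s \<partial>M) \<le> (\<integral>\<^sup>+s. G s * indicator {\<alpha><..<\<beta>} s \<partial>N)"
    by (intro nn_integral_mono_measure) (simp_all add: M_def N_def)
  also have "(\<integral>\<^sup>+s. G s * indicator {\<alpha><..<\<beta>} s \<partial>M) = (\<integral>\<^sup>+s\<in>{\<alpha><..<\<beta>}. G s \<partial>lborel)"
    unfolding M_def by (subst nn_integral_density) (auto intro!: nn_integral_cong simp: indicator_def)
  also have "(\<integral>\<^sup>+s. G s * indicator {\<alpha><..<\<beta>} s \<partial>N)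
      = (\<integral>\<^sup>+z\<in>{a..b}. (G (R z) * indicator {\<alpha><..<\<beta>} (R z)) * m z \<partial>lborel)"
    unfolding N_def
    by (subst nn_integral_distr, simp, simp, subst nn_integral_density)
      (auto intro!: nn_integral_cong simp: mult_ac)
  finally show ?thesis .
qed

text \<open>Upper half; \<open>var\<close> rules out oscillation. The preimage \<open>A\<close> of
  \<open>(s,t)\<close> is enclosed in its hull \<open>[Inf A, Sup A]\<close>, whose whole mass is at
  most the net change of \<open>R\<close> between the two ends, and that is at most the length of
  \<open>[l,u] \<inter> (s,t)\<close>.\<close>

lemma nn_integral_ge_monotone:
  fixes R :: "real \<Rightarrow> real" and m G :: "real \<Rightarrow> ennreal"
  assumes R: "continuous_on UNIV R" and m[measurable]: "m \<in> borel_measurable borel"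
    and G[measurable]: "G \<in> borel_measurable borel"
    and var: "\<And>x y. a \<le> x \<Longrightarrow> x \<le> y \<Longrightarrow> y \<le> b \<Longrightarrow> (\<integral>\<^sup>+z\<in>{x..y}. m z \<partial>lborel) \<le> ennreal \<bar>R y - R x\<bar>"
    and range: "R ` {a..b} \<subseteq> {l..u}"
  shows "(\<integral>\<^sup>+z\<in>{a..b}. G (R z) * m z \<partial>lborel) \<le> (\<integral>\<^sup>+s\<in>{l..u}. G s \<partial>lborel)"
proof -
  have R'[measurable]: "R \<in> borel_measurable borel"
    using R by (rule borel_measurable_continuous_onI)
  define N where "N = density lborel (indicator {l..u} :: real \<Rightarrow> ennreal)"
  define M where "M = distr (density lborel (\<lambda>z. m z * indicator {a..b} z)) borel R"
  have M: "emeasure M X = (\<integral>\<^sup>+z. m z * indicator {a..b} z * indicator (R -` X) z \<partial>lborel)"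
    if X: "X \<in> sets borel" for X
  proof -
    have "R -` X \<in> sets borel" using measurable_sets_borel[OF R' X] by simp
    then show ?thesis unfolding M_def using X by (simp add: emeasure_distr emeasure_density)
  qed
  have N: "emeasure N X = emeasure lborel ({l..u} \<inter> X)" if "X \<in> sets borel" for X
    using that by (simp add: N_def emeasure_density indicator_inter_arith[symmetric])
  have "M \<le> N"
  proof (rule measure_le_if_le_on_intervals)
    show "emeasure N (space N) \<noteq> \<infinity>"
      using N[of UNIV] by (simp add: N_def emeasure_lborel_Icc_eq)
  next
    fix s t :: real assume "s < t"
    define A where "A = {z \<in> {a..b}. s < R z \<and> R z < t}"
    show "emeasure M {s<..<t} \<le> emeasure N {s<..<t}"
    proof (cases "A = {}")
      case True
      have "emeasure M {s<..<t} = 0"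
        unfolding M[of "{s<..<t}", simplified]
        by (rule nn_integral_zero) (use True in \<open>auto simp: A_def indicator_def\<close>)
      then show ?thesis by simp
    next
      case False
      \<comment> \<open>\<open>B\<close> is closed, so it contains \<open>Inf A\<close> and
        \<open>Sup A\<close>; at these points \<open>R\<close> is only known to lie in the closed
        interval \<open>[s,t]\<close>.\<close>
      define B where "B = {a..b} \<inter> R -` {s..t}"
      have "closed B" unfolding B_def
        by (intro continuous_closed_preimage continuous_on_subset[OF R]) auto
      have "A \<subseteq> B" by (auto simp: A_def B_def)
      have bdd: "bdd_below A" "bdd_above A" unfolding A_def by (auto intro!: bdd_belowI[of _ a] bdd_aboveI[of _ b])
      let ?c = "Inf A" and ?d = "Sup A"
      have "closure A \<subseteq> B" using \<open>A \<subseteq> B\<close> \<open>closed B\<close> by (rule closure_minimal)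
      then have cd: "?c \<in> B" "?d \<in> B"
        using closure_contains_Inf[OF False bdd(1)] closure_contains_Sup[OF False bdd(2)] by auto
      have A: "?c \<le> z \<and> z \<le> ?d" if "z \<in> A" for z
        using cInf_lower[OF that bdd(1)] cSup_upper[OF that bdd(2)] by simp
      have "?c \<le> ?d" using False A by force
      have "emeasure M {s<..<t} \<le> (\<integral>\<^sup>+z\<in>{?c..?d}. m z \<partial>lborel)"
        unfolding M[of "{s<..<t}", simplified]
        by (intro nn_integral_mono) (use A in \<open>auto simp: indicator_def A_def\<close>)
      also have "\<dots> \<le> ennreal \<bar>R ?d - R ?c\<bar>"
        by (rule var) (use cd \<open>?c \<le> ?d\<close> in \<open>auto simp: B_def\<close>)
      \<comment> \<open>Measured by an open interval, the net change stays inside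
        \<open>(s,t)\<close> even when an end value equals \<open>s\<close> or
        \<open>t\<close>.\<close>
      also have "\<dots> = emeasure lborel {min (R ?c) (R ?d) <..< max (R ?c) (R ?d)}"
        by (simp add: min_def max_def)
      also have "\<dots> \<le> emeasure lborel ({l..u} \<inter> {s<..<t})"
      proof (rule emeasure_mono)
        have "R ?c \<in> {l..u}" "R ?d \<in> {l..u}" using cd range by (auto simp: B_def image_subset_iff)
        then show "{min (R ?c) (R ?d) <..< max (R ?c) (R ?d)} \<subseteq> {l..u} \<inter> {s<..<t}"
          using cd unfolding B_def by auto
      qed simp
      finally show ?thesis by (simp add: N)
    qed
  qed (simp_all add: M_def N_def)
  then have "(\<integral>\<^sup>+s. G s \<partial>M) \<le> (\<integral>\<^sup>+s. G s \<partial>N)"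
    by (intro nn_integral_mono_measure) (simp_all add: M_def N_def)
  also have "(\<integral>\<^sup>+s. G s \<partial>N) = (\<integral>\<^sup>+s\<in>{l..u}. G s \<partial>lborel)"
    unfolding N_def by (subst nn_integral_density) (auto intro!: nn_integral_cong simp: mult_ac)
  also have "(\<integral>\<^sup>+s. G s \<partial>M) = (\<integral>\<^sup>+z\<in>{a..b}. G (R z) * m z \<partial>lborel)"
    unfolding M_def
    by (subst nn_integral_distr, simp, simp, subst nn_integral_density)
      (auto intro!: nn_integral_cong simp: mult_ac)
  finally show ?thesis .
qed

text \<open>\<open>M\<close> and \<open>N\<close> carry the negative and positive parts of
  \<open>h\<close> as densities (\<open>ennreal\<close> cuts negative numbers to 0). The hypothesis
  says \<open>M \<le> N\<close> on intervals, hence on the set where \<open>h < 0\<close>, and there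
  \<open>N\<close> vanishes.\<close>

lemma AE_nonneg_if_integral_nonneg:
  fixes h :: "real \<Rightarrow> real"
  assumes h: "set_integrable lborel {a..b} h"
    and hm[measurable]: "h \<in> borel_measurable borel"
    and nonneg: "\<And>x y. a \<le> x \<Longrightarrow> x \<le> y \<Longrightarrow> y \<le> b \<Longrightarrow> 0 \<le> (LINT z:{x..y}|lborel. h z)"
  shows "AE z in lborel. z \<in> {a..b} \<longrightarrow> 0 \<le> h z"
proof -
  define M where "M = density lborel (\<lambda>z. ennreal (- h z) * indicator {a..b} z)"
  define N where "N = density lborel (\<lambda>z. ennreal (h z) * indicator {a..b} z)"
  have "M \<le> N"
  proof (rule measure_le_if_le_on_intervals)
    have "(\<integral>\<^sup>+z. ennreal (h z) * indicator {a..b} z \<partial>lborel) \<le> (\<integral>\<^sup>+z. ennreal (norm (indicator {a..b} z *\<^sub>R h z)) \<partial>lborel)"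
      by (intro nn_integral_mono) (auto simp: indicator_def intro: ennreal_leI)
    also have "\<dots> < \<infinity>"
      using h unfolding set_integrable_def integrable_iff_bounded by simp
    finally show "emeasure N (space N) \<noteq> \<infinity>"
      by (simp add: N_def emeasure_density)
  next
    fix s t :: real assume "s < t"
    let ?s = "max a s" and ?t = "min b t"
    let ?f = "\<lambda>z. indicator {?s..?t} z *\<^sub>R h z"
    have ae: "AE z in lborel. z \<noteq> s \<and> z \<noteq> t"
      using AE_lborel_singleton[of s] AE_lborel_singleton[of t] by eventually_elim simp
    have M: "emeasure M {s<..<t} = (\<integral>\<^sup>+z. ennreal (- ?f z) \<partial>lborel)"
      unfolding M_def
      by (subst emeasure_density, simp, simp, rule nn_integral_cong_AE)
        (use ae in \<open>eventually_elim, auto simp: indicator_def\<close>)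
    have N: "emeasure N {s<..<t} = (\<integral>\<^sup>+z. ennreal (?f z) \<partial>lborel)"
      unfolding N_def
      by (subst emeasure_density, simp, simp, rule nn_integral_cong_AE)
        (use ae in \<open>eventually_elim, auto simp: indicator_def\<close>)
    have int: "integrable lborel ?f"
      using set_integrable_subset[OF h, of "{?s..?t}"] by (auto simp: set_integrable_def)
    have "0 \<le> integral\<^sup>L lborel ?f"
    proof (cases "?s \<le> ?t")
      case True
      then show ?thesis using nonneg[of ?s ?t] by (simp add: set_lebesgue_integral_def)
    qed simp
    also have "\<dots> = enn2real (\<integral>\<^sup>+z. ennreal (?f z) \<partial>lborel) - enn2real (\<integral>\<^sup>+z. ennreal (- ?f z) \<partial>lborel)"
      using int by (rule real_lebesgue_integral_def)
    finally have le: "enn2real (\<integral>\<^sup>+z. ennreal (- ?f z) \<partial>lborel) \<le> enn2real (\<integral>\<^sup>+z. ennreal (?f z) \<partial>lborel)" by simp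
    have fin: "(\<integral>\<^sup>+z. ennreal (?f z) \<partial>lborel) < top" "(\<integral>\<^sup>+z. ennreal (- ?f z) \<partial>lborel) < top"
      using int unfolding real_integrable_def by (simp_all add: less_top)
    from ennreal_leI[OF le] show "emeasure M {s<..<t} \<le> emeasure N {s<..<t}"
      unfolding M N ennreal_enn2real[OF fin(1)] ennreal_enn2real[OF fin(2)] .
  qed (simp_all add: M_def N_def)
  let ?E = "{z. h z < 0}"
  have "emeasure M ?E \<le> emeasure N ?E"
    using \<open>M \<le> N\<close> by (intro le_measureD3) (simp_all add: M_def N_def)
  also have "\<dots> = 0"
    unfolding N_def by (subst emeasure_density)
      (auto intro!: nn_integral_zero simp: indicator_def ennreal_neg)
  finally have "(\<integral>\<^sup>+z. ennreal (- h z) * indicator {a..b} z * indicator ?E z \<partial>lborel) = 0"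
    unfolding M_def by (subst (asm) emeasure_density) auto
  then have "AE z in lborel. ennreal (- h z) * indicator {a..b} z * indicator ?E z = 0"
    by (subst (asm) nn_integral_0_iff_AE) auto
  then show ?thesis
    by eventually_elim (auto simp: indicator_def ennreal_eq_0_iff split: if_splits)
qed

section \<open>Test functions\<close>

text \<open>The first conjunct of \<open>test_fun\<close>, split off so that closure under
  differentiation can be treated apart from the support.\<close>

definition smooth :: "(real \<Rightarrow> real) \<Rightarrow> bool" where
  "smooth f \<longleftrightarrow> (\<forall>n x. (deriv ^^ n) f field_differentiable (at x))"

text \<open>Derivatives on the whole line are unique, so \<open>deriv\<close> maps a set closed
  under differentiation into itself, and every iterate is again a differentiable member.\<close>

lemma smooth_coinduct:
  assumes closed: "\<And>f. f \<in> S \<Longrightarrow> \<exists>f'\<in>S. \<forall>x. (f has_real_derivative f' x) (at x)"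
    and "f \<in> S"
  shows "smooth f"
proof -
  have "(deriv ^^ n) f \<in> S" for n
  proof (induction n)
    case (Suc n)
    then obtain f' where f': "f' \<in> S" "\<forall>x. ((deriv ^^ n) f has_real_derivative f' x) (at x)"
      using closed by blast
    then have "deriv ((deriv ^^ n) f) = f'" using DERIV_imp_deriv by blast
    with f' show ?case by simp
  qed (use \<open>f \<in> S\<close> in simp)
  then show ?thesis
    unfolding smooth_def using closed field_differentiable_def by blast
qed

lemma smooth_has_derivative: "smooth f \<Longrightarrow> (f has_real_derivative deriv f x) (at x)"
  unfolding smooth_def by (metis field_differentiable_derivI funpow_0)

lemma smooth_deriv: "smooth f \<Longrightarrow> smooth (deriv f)"
  unfolding smooth_def by (metis comp_apply funpow_Suc_right)

lemma smooth_continuous: "smooth f \<Longrightarrow> continuous_on A f"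
  by (meson DERIV_isCont continuous_at_imp_continuous_on smooth_has_derivative)

lemma smooth_diff_cmult:
  assumes "smooth f" "smooth g"
  shows "smooth (\<lambda>x. f x - c * g x)"
proof (rule smooth_coinduct[of "{\<lambda>x. f x - c * g x | f g. smooth f \<and> smooth g}"])
  fix h assume "h \<in> {\<lambda>x. f x - c * g x | f g. smooth f \<and> smooth g}"
  then obtain f g where "h = (\<lambda>x. f x - c * g x)" "smooth f" "smooth g" by blast
  then show "\<exists>h'\<in>{\<lambda>x. f x - c * g x | f g. smooth f \<and> smooth g}. \<forall>x. (h has_real_derivative h' x) (at x)"
    by (intro bexI[of _ "\<lambda>x. deriv f x - c * deriv g x"])
      (auto intro!: derivative_eq_intros smooth_has_derivative smooth_deriv)
qed (use assms in blast)

lemma smooth_primitive: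
  assumes "smooth f'" "\<And>x. (f has_real_derivative f' x) (at x)"
  shows "smooth f"
proof (rule smooth_coinduct[of "insert f (Collect smooth)"])
  fix h assume "h \<in> insert f (Collect smooth)"
  then show "\<exists>h'\<in>insert f (Collect smooth). \<forall>x. (h has_real_derivative h' x) (at x)"
    using assms smooth_deriv smooth_has_derivative by blast
qed simp

section \<open>Explicit bump functions\<close>

text \<open>The classical \<open>exp (-1/x)\<close>, flat at 0, with a polynomial in
  \<open>1/x\<close> in front so that the family is closed under differentiation. The rate
  \<open>k\<close> stays free because it is later sent to 0.\<close>

definition flat :: "real \<Rightarrow> real poly \<Rightarrow> real \<Rightarrow> real" where
  "flat k p x = (if x > 0 then poly p (1 / x) * exp (- k / x) else 0)"

lemma poly_mult_exp_tendsto_0: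
  assumes "k > 0"
  shows "((\<lambda>t::real. poly p t * exp (- k * t)) \<longlongrightarrow> 0) at_top"
proof -
  have lim: "((\<lambda>t. (k * t) ^ i / exp (k * t)) \<longlongrightarrow> 0) at_top" for i
    by (rule filterlim_compose[OF tendsto_power_div_exp_0])
      (use assms in \<open>auto intro!: filterlim_tendsto_pos_mult_at_top[OF tendsto_const _ filterlim_ident]\<close>)
  have "((\<lambda>t. \<Sum>i\<le>degree p. coeff p i / k ^ i * ((k * t) ^ i / exp (k * t))) \<longlongrightarrow> (\<Sum>i\<le>degree p. coeff p i / k ^ i * 0)) at_top"
    by (intro tendsto_sum tendsto_mult tendsto_const lim)
  moreover have "(\<Sum>i\<le>degree p. coeff p i / k ^ i * ((k * t) ^ i / exp (k * t))) = poly p t * exp (- k * t)" for t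
    using assms unfolding poly_altdef sum_distrib_right
    by (intro sum.cong) (auto simp: power_mult_distrib exp_minus field_simps)
  ultimately show ?thesis by simp
qed

text \<open>With \<open>t = 1/x\<close> and \<open>dt/dx = -t^2\<close>, differentiating
  \<open>p t * exp (-k t)\<close> gives \<open>t^2 (k p - p') exp (-k t)\<close>;
  \<open>[:0, 0, 1:]\<close> is the factor \<open>t^2\<close>.\<close>

lemma flat_has_derivative:
  assumes "k > 0"
  shows "(flat k p has_real_derivative flat k ([:0, 0, 1:] * (smult k p - pderiv p)) x) (at x)"
proof -
  consider "x > 0" | "x < 0" | "x = 0" by linarith
  then show ?thesis
  proof cases
    case 1
    have "((\<lambda>x. poly p (1 / x) * exp (- k / x)) has_real_derivative
        flat k ([:0, 0, 1:] * (smult k p - pderiv p)) x) (at x)"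
      using 1 by (auto intro!: derivative_eq_intros DERIV_chain2[OF poly_DERIV]
          simp: flat_def field_simps power2_eq_square)
    then show ?thesis
      by (rule has_field_derivative_transform_within_open[of _ _ _ "{0<..}"])
        (use 1 in \<open>auto simp: flat_def\<close>)
  next
    case 2
    have "((\<lambda>x. 0) has_real_derivative flat k ([:0, 0, 1:] * (smult k p - pderiv p)) x) (at x)"
      using 2 by (auto simp: flat_def)
    then show ?thesis
      by (rule has_field_derivative_transform_within_open[of _ _ _ "{..<0}"])
        (use 2 in \<open>auto simp: flat_def\<close>)
  next
    case 3
    have "((\<lambda>h. flat k p h / h) \<longlongrightarrow> 0) (at_right 0)"
      unfolding filterlim_at_right_to_top
    proof (rule Lim_transform_eventually)
      \<comment> \<open>Under \<open>h = 1/t\<close> the difference quotient at 0 is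
        \<open>t * p t * exp (-k t)\<close>; \<open>pCons 0 p\<close> absorbs the extra
        \<open>t\<close>.\<close>
      show "((\<lambda>t. poly (pCons 0 p) t * exp (- k * t)) \<longlongrightarrow> 0) at_top"
        using assms by (rule poly_mult_exp_tendsto_0)
      show "\<forall>\<^sub>F t in at_top. poly (pCons 0 p) t * exp (- k * t) = flat k p (inverse t) / inverse t"
        using eventually_gt_at_top[of 0] by eventually_elim (auto simp: flat_def field_simps)
    qed
    moreover have "((\<lambda>h. flat k p h / h) \<longlongrightarrow> 0) (at_left 0)"
    proof (rule Lim_transform_eventually[OF tendsto_const[of 0]])
      show "\<forall>\<^sub>F h in at_left 0. 0 = flat k p h / h"
        using eventually_at_left_real[of "-1" 0] by (auto elim!: eventually_mono simp: flat_def)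
    qed
    ultimately show ?thesis
      unfolding 3 has_field_derivative_iff by (simp add: filterlim_split_at flat_def)
  qed
qed

inductive_set bumps :: "real \<Rightarrow> real \<Rightarrow> real \<Rightarrow> (real \<Rightarrow> real) set" for k a b where
  prod: "(\<lambda>x. flat k p (x - a) * flat k q (b - x)) \<in> bumps k a b"
| add: "f \<in> bumps k a b \<Longrightarrow> g \<in> bumps k a b \<Longrightarrow> (\<lambda>x. f x + g x) \<in> bumps k a b"

lemma bumps_deriv:
  assumes "k > 0" "f \<in> bumps k a b"
  shows "\<exists>f'\<in>bumps k a b. \<forall>x. (f has_real_derivative f' x) (at x)"
  using assms(2)
proof induction
  case (prod p q)
  define D where "D = (\<lambda>p. [:0, 0, 1:] * (smult k p - pderiv p))"
  have D: "(flat k p has_real_derivative flat k (D p) x) (at x)" for p x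
    unfolding D_def by (rule flat_has_derivative[OF assms(1)])
  have neg: "flat k (- p) x = - flat k p x" for p x by (simp add: flat_def)
  let ?f' = "\<lambda>x. flat k (D p) (x - a) * flat k q (b - x) + flat k p (x - a) * flat k (- D q) (b - x)"
  have "((\<lambda>x. flat k p (x - a) * flat k q (b - x)) has_real_derivative ?f' x) (at x)" for x
    by (auto intro!: derivative_eq_intros DERIV_chain2[OF D] simp: neg)
  moreover have "?f' \<in> bumps k a b" by (intro bumps.intros)
  ultimately show ?case by (intro bexI[of _ ?f'] allI)
next
  case (add f g)
  then obtain f' g' where "f' \<in> bumps k a b" "\<forall>x. (f has_real_derivative f' x) (at x)"
    "g' \<in> bumps k a b" "\<forall>x. (g has_real_derivative g' x) (at x)" by blast
  then show ?case
    by (intro bexI[of _ "\<lambda>x. f' x + g' x"]) (auto intro: bumps.add DERIV_add)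
qed

definition bump :: "real \<Rightarrow> real \<Rightarrow> real \<Rightarrow> real \<Rightarrow> real" where
  "bump k a b x = flat k 1 (x - a) * flat k 1 (b - x)"

lemma test_fun_bump:
  assumes "k > 0"
  shows "test_fun (bump k a b)"
proof -
  have "smooth (bump k a b)"
    using smooth_coinduct[OF bumps_deriv[OF assms]] bumps.prod[of k 1 a 1 b]
    unfolding bump_def[abs_def] by blast
  moreover have "bounded {x. bump k a b x \<noteq> 0}"
    by (rule bounded_subset[of "{a..b}"]) (auto simp: bump_def flat_def)
  ultimately show ?thesis by (simp add: test_fun_def smooth_def)
qed

lemma bump_nonneg: "0 \<le> bump k a b x"
  by (simp add: bump_def flat_def)

lemma bump_le_indicator: "k > 0 \<Longrightarrow> bump k a b x \<le> indicator {a..b} x"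
  by (auto simp: bump_def flat_def indicator_def mult_le_one)

lemma bump_pos: "a < x \<Longrightarrow> x < b \<Longrightarrow> 0 < bump k a b x"
  by (simp add: bump_def flat_def)

text \<open>Each exponential tends to 1 where its argument is positive. At \<open>a\<close> and
  \<open>b\<close> one factor is 0 for every \<open>n\<close>, hence the open interval in the
  limit.\<close>

lemma bump_tendsto_indicator: "(\<lambda>n. bump (1 / Suc n) a b x) \<longlonglongrightarrow> indicator {a<..<b} x"
proof -
  have "(\<lambda>n. exp (- (1 / real (Suc n)) / y)) \<longlonglongrightarrow> exp (- 0 / y)" for y :: real
    using LIMSEQ_Suc[OF lim_1_over_n[where 'a = real]]
    \<comment> \<open>At \<open>y = 0\<close> both sides are \<open>exp 0\<close>, since
      \<open>x / 0 = 0\<close>; \<open>flat\<close> only asks for \<open>y > 0\<close>.\<close>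
    by (cases "y = 0") (simp, intro tendsto_intros)
  then have "(\<lambda>n. flat (1 / real (Suc n)) 1 y) \<longlonglongrightarrow> (if y > 0 then 1 else 0)" for y
    by (simp add: flat_def)
  from tendsto_mult[OF this this]
  have "(\<lambda>n. bump (1 / Suc n) a b x) \<longlonglongrightarrow> (if x - a > 0 then 1 else 0) * (if b - x > 0 then 1 else 0)"
    unfolding bump_def .
  moreover have "(if x - a > 0 then 1 else 0) * (if b - x > 0 then 1 else 0) = (indicator {a<..<b} x :: real)"
    by (auto simp: indicator_def)
  ultimately show ?thesis by simp
qed

section \<open>Supports and combinations of test functions\<close>

lemma test_fun_smooth: "test_fun \<phi> \<Longrightarrow> smooth \<phi>"
  by (simp add: test_fun_def smooth_def)

lemma test_fun_support:
  assumes "test_fun \<phi>"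
  obtains a b where "a < b" "\<And>x. x \<notin> {a<..<b} \<Longrightarrow> \<phi> x = 0"
proof -
  have "bounded {x. \<phi> x \<noteq> 0}"
    using assms bounded_subset[OF compact_imp_bounded closure_subset] unfolding test_fun_def by blast
  then obtain c where c: "\<And>x. \<phi> x \<noteq> 0 \<Longrightarrow> \<bar>x\<bar> \<le> c" by (auto simp: bounded_iff)
  show ?thesis
  \<comment> \<open>The bound \<open>c\<close> may be negative when \<open>\<phi>\<close> vanishes
    identically; the absolute value and \<open>+ 1\<close> give a nonempty open interval around all
    points where \<open>\<phi>\<close> is nonzero.\<close>
  proof (rule that[of "- (\<bar>c\<bar> + 1)" "\<bar>c\<bar> + 1"])
    show "\<phi> x = 0" if "x \<notin> {- (\<bar>c\<bar> + 1)<..<\<bar>c\<bar> + 1}" for x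
    proof (rule ccontr)
      assume "\<phi> x \<noteq> 0"
      from c[OF this] that show False by (simp add: abs_le_iff)
    qed
  qed simp
qed

lemma test_funI:
  assumes "smooth \<phi>" "\<And>x. x \<notin> {a..b} \<Longrightarrow> \<phi> x = 0"
  shows "test_fun \<phi>"
proof -
  have "bounded {x. \<phi> x \<noteq> 0}" by (rule bounded_subset[of "{a..b}"]) (simp, use assms(2) in blast)
  with assms show ?thesis by (simp add: test_fun_def smooth_def)
qed

lemma test_fun_diff_cmult:
  assumes "test_fun \<phi>" "test_fun \<psi>"
  shows "test_fun (\<lambda>x. \<phi> x - c * \<psi> x)"
proof -
  obtain a b where \<phi>: "a < b" "\<And>x. x \<notin> {a<..<b} \<Longrightarrow> \<phi> x = 0"
    using test_fun_support[OF assms(1)] by blast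
  obtain a' b' where \<psi>: "a' < b'" "\<And>x. x \<notin> {a'<..<b'} \<Longrightarrow> \<psi> x = 0"
    using test_fun_support[OF assms(2)] by blast
  show ?thesis
  proof (rule test_funI)
    show "\<phi> x - c * \<psi> x = 0" if "x \<notin> {min a a'..max b b'}" for x
      using \<phi>(2)[of x] \<psi>(2)[of x] that by (cases "a \<le> x"; cases "x \<le> b"; cases "a' \<le> x"; cases "x \<le> b'") auto
  qed (intro smooth_diff_cmult test_fun_smooth assms)
qed

lemma test_fun_deriv_support:
  assumes "test_fun \<phi>" "\<And>x. x \<notin> {a<..<b} \<Longrightarrow> \<phi> x = 0" "x \<notin> {a..b}"
  shows "deriv \<phi> x = 0"
proof -
  have "((\<lambda>_. 0) has_real_derivative 0) (at x)" by simp
  then have "(\<phi> has_real_derivative 0) (at x)"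
    by (rule has_field_derivative_transform_within_open[of _ _ _ "- {a..b}"]) (use assms in auto)
  then show ?thesis by (rule DERIV_imp_deriv)
qed

section \<open>The du Bois-Reymond lemma and continuous representatives\<close>

text \<open>A primitive is constant on either side of the support, and the vanishing mean makes the
  two constants equal; subtracting this constant leaves compact support.\<close>

lemma test_fun_primitive:
  assumes \<psi>: "test_fun \<psi>" and zero: "(LINT x|lborel. \<psi> x) = 0"
  obtains \<phi> where "test_fun \<phi>" "deriv \<phi> = \<psi>"
proof -
  have cont: "isCont \<psi> x" for x
    using smooth_has_derivative[OF test_fun_smooth[OF \<psi>]] DERIV_isCont by blast
  then obtain F where "\<forall>x. (F has_vector_derivative \<psi> x) (at x)"
    using einterval_antiderivative[of "-\<infinity>" "\<infinity>" \<psi>] by auto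
  then have F: "(F has_real_derivative \<psi> x) (at x)" for x
    by (simp add: has_real_derivative_iff_has_vector_derivative)
  obtain a b where ab: "a < b" "\<And>x. x \<notin> {a<..<b} \<Longrightarrow> \<psi> x = 0"
    using test_fun_support[OF \<psi>] by blast
  have FTC: "(LINT t|lborel. \<psi> t * indicator {x..y} t) = F y - F x" if "x \<le> y" for x y
    using that F cont by (intro integral_FTC_Icc_real) auto
  have left: "F x = F a" if "x \<le> a" for x
  proof -
    have "(LINT t|lborel. \<psi> t * indicator {x..a} t) = (LINT t::real|lborel. 0)"
      by (rule Bochner_Integration.integral_cong) (use ab in \<open>auto simp: indicator_def\<close>)
    with FTC[OF that] show ?thesis by simp
  qed
  have right: "F x = F a" if "b \<le> x" for x
  proof -
    have "(LINT t|lborel. \<psi> t * indicator {a..x} t) = (LINT t|lborel. \<psi> t)"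
    proof (rule Bochner_Integration.integral_cong)
      show "\<psi> t * indicator {a..x} t = \<psi> t" for t
        using ab(2)[of t] that by (cases "t \<in> {a<..<b}") auto
    qed simp
    with FTC[of a x] zero ab that show ?thesis by simp
  qed
  have der: "((\<lambda>x. F x - F a) has_real_derivative \<psi> x) (at x)" for x
    using F[of x] by (auto intro!: derivative_eq_intros)
  have "test_fun (\<lambda>x. F x - F a)"
  proof (rule test_funI)
    show "smooth (\<lambda>x. F x - F a)" by (rule smooth_primitive[OF test_fun_smooth[OF \<psi>] der])
    show "F x - F a = 0" if "x \<notin> {a..b}" for x using left[of x] right[of x] that by auto
  qed
  moreover have "deriv (\<lambda>x. F x - F a) = \<psi>" using der DERIV_imp_deriv by blast
  ultimately show ?thesis using that by blast
qed

section \<open>Integration by parts against a test function\<close>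

lemma integrable_scaleR_of_compact_support:
  fixes f :: "real \<Rightarrow> 'a::euclidean_space" and \<phi> :: "real \<Rightarrow> real"
  assumes f: "\<And>a b. set_integrable lborel {a..b} f" and fm[measurable]: "f \<in> borel_measurable borel"
    and \<phi>: "continuous_on UNIV \<phi>" "\<And>x. x \<notin> {a..b} \<Longrightarrow> \<phi> x = 0"
  shows "integrable lborel (\<lambda>x. \<phi> x *\<^sub>R f x)"
proof -
  have [measurable]: "\<phi> \<in> borel_measurable borel" using \<phi>(1) by (rule borel_measurable_continuous_onI)
  have "compact (\<phi> ` {a..b})"
    by (intro compact_continuous_image continuous_on_subset[OF \<phi>(1)]) auto
  then obtain M where M: "\<forall>x\<in>{a..b}. \<bar>\<phi> x\<bar> \<le> M"
    using compact_imp_bounded[of "\<phi> ` {a..b}"] by (auto simp: bounded_iff)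
  show ?thesis
  proof (rule Bochner_Integration.integrable_bound)
    show "integrable lborel (\<lambda>x. M *\<^sub>R (indicator {a..b} x *\<^sub>R f x))"
      using f[of a b] unfolding set_integrable_def by (intro integrable_scaleR_right)
    show "AE x in lborel. norm (\<phi> x *\<^sub>R f x) \<le> norm (M *\<^sub>R (indicator {a..b} x *\<^sub>R f x))"
      using M \<phi>(2) by (intro AE_I2) (force simp: indicator_def intro!: mult_right_mono)
  qed simp
qed

lemma integrable_scaleR_pair:
  fixes p :: "real \<Rightarrow> real" and q :: "real \<Rightarrow> 'a::euclidean_space"
  assumes "integrable lborel p" "integrable lborel q"
  shows "integrable (lborel \<Otimes>\<^sub>M lborel) (\<lambda>(t, x). p t *\<^sub>R q x)"
proof -
  have [measurable]: "p \<in> borel_measurable lborel" "q \<in> borel_measurable lborel" using assms by auto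
  show ?thesis
    by (rule lborel_pair.Fubini_integrable) (use assms in auto)
qed

text \<open>\<open>P\<close> is merely a primitive of a locally integrable function. Instead of a
  pointwise product rule, Fubini is applied to \<open>deriv \<phi> t *\<^sub>R v x\<close> on the
  triangle \<open>A \<le> t \<le> x \<le> B\<close>: one order of integration gives
  \<open>\<phi> x *\<^sub>R v x\<close>, the other
  \<open>deriv \<phi> t *\<^sub>R (P B - P t)\<close>.\<close>

lemma integral_by_parts_test_fun:
  fixes P v :: "real \<Rightarrow> 'a::euclidean_space"
  assumes \<phi>: "test_fun \<phi>"
    and v: "\<And>a b. set_integrable lborel {a..b} v" and vm[measurable]: "v \<in> borel_measurable borel"
    and P: "continuous_on UNIV P" "\<And>x y. x \<le> y \<Longrightarrow> P y - P x = (LINT t:{x..y}|lborel. v t)"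
  shows "(LINT x|lborel. deriv \<phi> x *\<^sub>R P x) = - (LINT x|lborel. \<phi> x *\<^sub>R v x)"
proof -
  obtain A B where AB: "A < B" "\<And>x. x \<notin> {A<..<B} \<Longrightarrow> \<phi> x = 0"
    using test_fun_support[OF \<phi>] by blast
  have \<psi>0: "deriv \<phi> x = 0" if "x \<notin> {A..B}" for x
    using test_fun_deriv_support[OF \<phi> AB(2) that] .
  have der: "(\<phi> has_real_derivative deriv \<phi> x) (at x)" for x
    using smooth_has_derivative[OF test_fun_smooth[OF \<phi>]] .
  have cont: "continuous_on UNIV (deriv \<phi>)"
    using smooth_continuous[OF smooth_deriv[OF test_fun_smooth[OF \<phi>]]] .
  have [measurable]: "deriv \<phi> \<in> borel_measurable borel" "P \<in> borel_measurable borel"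
    using cont P(1) by (auto intro: borel_measurable_continuous_onI)
  have FTC: "(LINT t|lborel. deriv \<phi> t * indicator {x..y} t) = \<phi> y - \<phi> x" if "x \<le> y" for x y
    using that der cont by (intro integral_FTC_Icc_real) (auto simp: continuous_on_eq_continuous_at)
  define f where "f = (\<lambda>t x. indicator {A..x} t *\<^sub>R (deriv \<phi> t *\<^sub>R (indicator {A..B} x *\<^sub>R v x)))"
  have \<psi>int: "integrable lborel (deriv \<phi>)"
    using integrable_scaleR_of_compact_support[of "\<lambda>_. 1 :: real" "deriv \<phi>" A B, OF _ _ cont \<psi>0]
    by (simp add: borel_integrable_atLeastAtMost')
  have "integrable (lborel \<Otimes>\<^sub>M lborel) (case_prod f)"
  proof (rule Bochner_Integration.integrable_bound)
    show "integrable (lborel \<Otimes>\<^sub>M lborel) (\<lambda>(t, x). deriv \<phi> t *\<^sub>R (indicator {A..B} x *\<^sub>R v x))"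
      using \<psi>int v[of A B] unfolding set_integrable_def by (rule integrable_scaleR_pair)
    have [measurable]: "{z::real \<times> real. fst z \<in> {A..snd z}} \<in> sets (lborel \<Otimes>\<^sub>M lborel)"
    proof -
      have "{z::real \<times> real. fst z \<in> {A..snd z}} = {z. A \<le> fst z} \<inter> {z. fst z \<le> snd z}" by auto
      moreover have "closed \<dots>"
        by (intro closed_Int closed_Collect_le continuous_intros)
      ultimately show ?thesis by (simp add: borel_prod)
    qed
    have "case_prod f = (\<lambda>z. indicator {z. fst z \<in> {A..snd z}} z *\<^sub>R
        (deriv \<phi> (fst z) *\<^sub>R (indicator {A..B} (snd z) *\<^sub>R v (snd z))))"
      by (auto simp: f_def indicator_def fun_eq_iff)
    then show "case_prod f \<in> borel_measurable (lborel \<Otimes>\<^sub>M lborel)" by simp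
    show "AE z in lborel \<Otimes>\<^sub>M lborel. norm (case_prod f z)
        \<le> norm (case z of (t, x) \<Rightarrow> deriv \<phi> t *\<^sub>R (indicator {A..B} x *\<^sub>R v x))"
      by (intro AE_I2) (auto simp: f_def indicator_def)
  qed
  then have Fubini: "(LINT x|lborel. LINT t|lborel. f t x) = (LINT t|lborel. LINT x|lborel. f t x)"
    by (rule lborel_pair.Fubini_integral)
  have inner_t: "(LINT t|lborel. f t x) = \<phi> x *\<^sub>R v x" for x
  proof (cases "x \<in> {A..B}")
    case True
    have "(LINT t|lborel. f t x) = (LINT t|lborel. (deriv \<phi> t * indicator {A..x} t) *\<^sub>R v x)"
      using True by (intro Bochner_Integration.integral_cong) (auto simp: f_def mult.commute)
    also have "\<dots> = (LINT t|lborel. deriv \<phi> t * indicator {A..x} t) *\<^sub>R v x"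
      by (rule integral_scaleR_left) (use \<psi>int integrable_mult_indicator[of "{A..x}" lborel "deriv \<phi>"] in \<open>simp add: mult.commute\<close>)
    finally show ?thesis using FTC[of A x] True AB by simp
  qed (use AB(2)[of x] in \<open>auto simp: f_def\<close>)
  have inner_x: "(LINT x|lborel. f t x) = deriv \<phi> t *\<^sub>R (P B - P t)" for t
  proof (cases "t \<in> {A..B}")
    case True
    have "(LINT x|lborel. f t x) = (LINT x|lborel. deriv \<phi> t *\<^sub>R (indicator {t..B} x *\<^sub>R v x))"
      using True by (intro Bochner_Integration.integral_cong) (auto simp: f_def indicator_def)
    also have "\<dots> = deriv \<phi> t *\<^sub>R (P B - P t)"
      using True P(2)[of t B] by (simp add: set_lebesgue_integral_def del: scaleR_scaleR)
    finally show ?thesis .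
  qed (use \<psi>0[of t] in \<open>auto simp: f_def\<close>)
  have "(LINT x|lborel. \<phi> x *\<^sub>R v x) = (LINT t|lborel. deriv \<phi> t *\<^sub>R (P B - P t))"
    using Fubini unfolding inner_t inner_x .
  also have "(LINT t|lborel. deriv \<phi> t *\<^sub>R (P B - P t))
      = (LINT t|lborel. deriv \<phi> t *\<^sub>R P B) - (LINT t|lborel. deriv \<phi> t *\<^sub>R P t)"
  proof -
    have "set_integrable lborel {a..b} P" for a b
      by (intro borel_integrable_atLeastAtMost' continuous_on_subset[OF P(1)]) simp
    then have "integrable lborel (\<lambda>t. deriv \<phi> t *\<^sub>R P t)"
      by (rule integrable_scaleR_of_compact_support[OF _ _ cont \<psi>0]) simp
    then show ?thesis unfolding scaleR_diff_right
      by (intro Bochner_Integration.integral_diff integrable_scaleR_left \<psi>int)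
  qed
  \<comment> \<open>The constant drops out since \<open>deriv \<phi>\<close> integrates to
    \<open>\<phi> B - \<phi> A = 0\<close>.\<close>
  also have "(LINT t|lborel. deriv \<phi> t *\<^sub>R P B) = 0"
  proof -
    have "(LINT t|lborel. deriv \<phi> t) = (LINT t|lborel. deriv \<phi> t * indicator {A..B} t)"
      by (intro Bochner_Integration.integral_cong) (use \<psi>0 in \<open>auto simp: indicator_def\<close>)
    also have "\<dots> = 0" using FTC[of A B] AB(1) AB(2)[of A] AB(2)[of B] by simp
    finally show ?thesis using \<psi>int by simp
  qed
  finally show ?thesis by simp
qed

text \<open>The sign criterion applied to \<open>h \<bullet> e\<close> and
  \<open>h \<bullet> (- e)\<close> for each basis vector \<open>e\<close> makes every component
  vanish; the intervals \<open>[-n, n]\<close> exhaust the line.\<close>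

lemma AE_zero_if_integral_zero:
  fixes h :: "real \<Rightarrow> 'a::euclidean_space"
  assumes h: "\<And>a b. set_integrable lborel {a..b} h" and hm[measurable]: "h \<in> borel_measurable borel"
    and zero: "\<And>a b. a \<le> b \<Longrightarrow> (LINT x:{a..b}|lborel. h x) = 0"
  shows "AE x in lborel. h x = 0"
proof -
  have comp: "AE x in lborel. 0 \<le> h x \<bullet> e" for e
  proof -
    have "AE x in lborel. x \<in> {- real n..real n} \<longrightarrow> 0 \<le> h x \<bullet> e" for n :: nat
    proof (rule AE_nonneg_if_integral_nonneg)
      have *: "indicator A x *\<^sub>R (h x \<bullet> e) = (indicator A x *\<^sub>R h x) \<bullet> e" for A x by simp
      show "set_integrable lborel {- real n..real n} (\<lambda>x. h x \<bullet> e)"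
        using h unfolding set_integrable_def * by (intro integrable_inner_left) 
      show "0 \<le> (LINT z:{x..y}|lborel. h z \<bullet> e)" if "x \<le> y" for x y
        using zero[OF that] h[of x y]
        unfolding set_lebesgue_integral_def set_integrable_def * by (subst integral_inner_left) auto
    qed simp
    then have "AE x in lborel. \<forall>n. x \<in> {- real n..real n} \<longrightarrow> 0 \<le> h x \<bullet> e"
      unfolding AE_all_countable by blast
    then show ?thesis
    proof eventually_elim
      case (elim x)
      obtain n where "\<bar>x\<bar> < real n" using reals_Archimedean2 by blast
      then have "x \<in> {- real n..real n}" by (auto simp: abs_less_iff)
      with elim show ?case by blast
    qed
  qed
  have "AE x in lborel. \<forall>e\<in>Basis. 0 \<le> h x \<bullet> e \<and> 0 \<le> h x \<bullet> (- e)"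
    by (intro AE_finite_allI finite_Basis AE_conjI comp)
  then show ?thesis
  proof eventually_elim
    case (elim x)
    have "h x \<bullet> e = 0 \<bullet> e" if "e \<in> Basis" for e
      using bspec[OF elim that] by (simp add: order_antisym)
    then show ?case by (rule euclidean_eqI)
  qed
qed

text \<open>A test function \<open>\<psi>\<close> minus a suitable multiple of a fixed one with
  nonzero integral has mean zero, hence is the derivative of a test function, and the hypothesis
  applies. So \<open>h\<close> and a constant \<open>c\<close> have the same integrals against all
  test functions and, as bumps tend to indicators, over all intervals.\<close>

lemma du_Bois_Reymond:
  fixes h :: "real \<Rightarrow> 'a::euclidean_space"
  assumes h: "\<And>a b. set_integrable lborel {a..b} h" and hm[measurable]: "h \<in> borel_measurable borel"
    and zero: "\<And>\<phi>. test_fun \<phi> \<Longrightarrow> (LINT x|lborel. deriv \<phi> x *\<^sub>R h x) = 0"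
  obtains c where "AE x in lborel. h x = c"
proof -
  define \<theta> where "\<theta> = bump 1 0 1"
  have \<theta>: "test_fun \<theta>" unfolding \<theta>_def by (rule test_fun_bump) simp
  have int: "integrable lborel (\<lambda>x. \<phi> x *\<^sub>R f x)"
    if \<phi>: "test_fun \<phi>" and f: "\<And>a b. set_integrable lborel {a..b} f" "f \<in> borel_measurable borel"
    for \<phi> and f :: "real \<Rightarrow> 'b::euclidean_space"
  proof -
    obtain a b where "\<And>x. x \<notin> {a<..<b} \<Longrightarrow> \<phi> x = 0" using test_fun_support[OF \<phi>] by blast
    then show ?thesis
      by (intro integrable_scaleR_of_compact_support[OF f, of \<phi> a b] smooth_continuous[OF test_fun_smooth[OF \<phi>]]) auto
  qed
  have one: "set_integrable lborel {a..b} (\<lambda>_. 1 :: real)" for a b :: real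
    by (simp add: borel_integrable_atLeastAtMost')
  have int1: "integrable lborel \<phi>" if "test_fun \<phi>" for \<phi>
    using int[OF that one] by simp
  define I where "I = (LINT x|lborel. \<theta> x)"
  have "I \<noteq> 0"
  proof
    assume "I = 0"
    then have "AE x in lborel. \<theta> x = 0"
      using integral_nonneg_eq_0_iff_AE[OF int1[OF \<theta>]] bump_nonneg by (simp add: I_def \<theta>_def)
    then have "AE x in lborel. x \<notin> {0<..<1::real}"
      by eventually_elim (use bump_pos[of 0 _ 1 1] in \<open>force simp: \<theta>_def\<close>)
    then have "{0<..<1::real} \<in> null_sets lborel" by (subst (asm) AE_iff_null_sets[symmetric]) auto
    then show False by (auto dest: null_setsD1)
  qed
  \<comment> \<open>Forced by the desired identity in the case
    \<open>\<psi> = \<theta>\<close>.\<close>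
  define c where "c = (1 / I) *\<^sub>R (LINT x|lborel. \<theta> x *\<^sub>R h x)"
  have key: "(LINT x|lborel. \<psi> x *\<^sub>R h x) = (LINT x|lborel. \<psi> x) *\<^sub>R c" if \<psi>: "test_fun \<psi>" for \<psi>
  proof -
    define k where "k = (LINT x|lborel. \<psi> x) / I"
    have "test_fun (\<lambda>x. \<psi> x - k * \<theta> x)" using \<psi> \<theta> by (rule test_fun_diff_cmult)
    moreover have "(LINT x|lborel. \<psi> x - k * \<theta> x) = 0"
      using int1[OF \<psi>] int1[OF \<theta>] \<open>I \<noteq> 0\<close> by (simp add: k_def I_def[symmetric])
    ultimately obtain \<phi> where "test_fun \<phi>" "deriv \<phi> = (\<lambda>x. \<psi> x - k * \<theta> x)"
      by (rule test_fun_primitive)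
    from zero[OF this(1), unfolded this(2)]
    have "(LINT x|lborel. \<psi> x *\<^sub>R h x - k *\<^sub>R (\<theta> x *\<^sub>R h x)) = 0"
      by (simp add: scaleR_diff_left)
    then have "(LINT x|lborel. \<psi> x *\<^sub>R h x) = k *\<^sub>R (LINT x|lborel. \<theta> x *\<^sub>R h x)"
      by (subst (asm) Bochner_Integration.integral_diff)
        (use int[OF \<psi> h] int[OF \<theta> h] in \<open>auto intro: integrable_scaleR_right simp del: scaleR_scaleR\<close>)
    then show ?thesis by (simp add: k_def c_def)
  qed
  have "AE x in lborel. h x - c = 0"
  proof (rule AE_zero_if_integral_zero)
    have c: "set_integrable lborel {a..b} (\<lambda>_. c)" for a b :: real
      by (intro borel_integrable_atLeastAtMost') simp
    show "set_integrable lborel {a..b} (\<lambda>x. h x - c)" for a b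
      using h c by (rule set_integral_diff)
    fix a b :: real assume "a \<le> b"
    \<comment> \<open>Dominated convergence, since bumps lie between 0 and the indicator of
      \<open>[a,b]\<close>. It is stated for a general \<open>f\<close> to serve both
      \<open>h\<close> and the constant \<open>c\<close>.\<close>
    have lim: "(\<lambda>n. LINT x|lborel. bump (1 / Suc n) a b x *\<^sub>R f x) \<longlonglongrightarrow> (LINT x:{a..b}|lborel. f x)"
      if f: "set_integrable lborel {a..b} f" "f \<in> borel_measurable borel" for f :: "real \<Rightarrow> 'a"
    proof -
      have bump_meas[measurable]: "bump (1 / Suc n) a b \<in> borel_measurable borel" for n
        by (intro borel_measurable_continuous_onI smooth_continuous test_fun_smooth test_fun_bump) simp
      note f(2)[measurable]
      have "(\<lambda>n. LINT x|lborel. bump (1 / Suc n) a b x *\<^sub>R f x) \<longlonglongrightarrow> (LINT x|lborel. indicator {a<..<b} x *\<^sub>R f x)"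
      proof (rule integral_dominated_convergence)
        show "integrable lborel (\<lambda>x. norm (indicator {a..b} x *\<^sub>R f x))"
          using f(1) unfolding set_integrable_def by (rule integrable_norm)
        show "AE x in lborel. (\<lambda>n. bump (1 / Suc n) a b x *\<^sub>R f x) \<longlonglongrightarrow> indicator {a<..<b} x *\<^sub>R f x"
          by (intro AE_I2 tendsto_scaleR bump_tendsto_indicator tendsto_const)
        show "AE x in lborel. norm (bump (1 / Suc n) a b x *\<^sub>R f x) \<le> norm (indicator {a..b} x *\<^sub>R f x)" for n
          using bump_nonneg[of "1 / Suc n" a b] bump_le_indicator[of "1 / Suc n" a b]
          by (intro AE_I2) (auto intro!: mult_right_mono)
      qed (use bump_meas in \<open>auto simp del: of_nat_Suc\<close>)
      also have "(LINT x|lborel. indicator {a<..<b} x *\<^sub>R f x) = (LINT x:{a..b}|lborel. f x)"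
        unfolding set_lebesgue_integral_def
        by (rule integral_cong_AE)
          (use AE_lborel_singleton[of a] AE_lborel_singleton[of b] in
            \<open>auto simp: indicator_def elim!: eventually_rev_mp\<close>)
      finally show ?thesis .
    qed
    have "(\<lambda>n. LINT x|lborel. bump (1 / Suc n) a b x *\<^sub>R h x) \<longlonglongrightarrow> (LINT x:{a..b}|lborel. h x)"
      using h by (rule lim) simp
    moreover have "(\<lambda>n. LINT x|lborel. bump (1 / Suc n) a b x *\<^sub>R h x) \<longlonglongrightarrow> (LINT x:{a..b}|lborel. c)"
    proof -
      have "(LINT x|lborel. bump (1 / Suc n) a b x *\<^sub>R h x) = (LINT x|lborel. bump (1 / Suc n) a b x *\<^sub>R c)" for n
        using key[of "bump (1 / Suc n) a b"] int1[of "bump (1 / Suc n) a b"] by (simp add: test_fun_bump)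
      with lim[OF c] show ?thesis by simp
    qed
    ultimately have "(LINT x:{a..b}|lborel. h x) = (LINT x:{a..b}|lborel. c)"
      by (rule LIMSEQ_unique)
    then show "(LINT x:{a..b}|lborel. h x - c) = 0"
      using h c by (subst set_integral_diff) auto
  qed simp
  then show ?thesis using that[of c] by simp
qed

section \<open>Borel representatives, primitives and the continuous representative\<close>

text \<open>Weak derivatives live on \<open>lebesgue\<close>, whereas image measures and Fubini are
  used on \<open>lborel\<close>; Borel representatives bridge the two. Each coordinate is replaced
  separately, the basis being finite.\<close>

lemma lebesgue_measurable_borel_rep:
  fixes f :: "real \<Rightarrow> 'a::euclidean_space"
  assumes f: "f \<in> borel_measurable lebesgue"
  obtains g where "g \<in> borel_measurable borel" "AE x in lebesgue. g x = f x"
proof -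
  have "\<exists>g\<in>borel_measurable lborel. AE x in lborel. f x \<bullet> e = g x" for e
    by (rule completion_ex_borel_measurable_real) (use f in measurable)
  then obtain g where g: "\<And>e. g e \<in> borel_measurable lborel" "\<And>e. AE x in lborel. f x \<bullet> e = g e x"
    by metis
  have "(\<lambda>x. \<Sum>e\<in>Basis. g e x *\<^sub>R e) \<in> borel_measurable borel" using g(1) by simp
  moreover have "AE x in lborel. \<forall>e\<in>Basis. f x \<bullet> e = g e x"
    by (intro AE_finite_allI finite_Basis g)
  then have "AE x in lborel. (\<Sum>e\<in>Basis. g e x *\<^sub>R e) = f x"
  proof eventually_elim
    case (elim x)
    then have "(\<Sum>e\<in>Basis. g e x *\<^sub>R e) = (\<Sum>e\<in>Basis. (f x \<bullet> e) *\<^sub>R e)" by simp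
    then show ?case by (simp add: euclidean_representation)
  qed
  ultimately show ?thesis using that AE_completion by blast
qed

lemma primitive_exists:
  fixes v :: "real \<Rightarrow> 'a::euclidean_space"
  assumes v: "\<And>a b. set_integrable lborel {a..b} v"
  obtains P where "continuous_on UNIV P" "\<And>x y. x \<le> y \<Longrightarrow> P y - P x = (LINT t:{x..y}|lborel. v t)"
proof -
  \<comment> \<open>The oriented integral from 0, so that \<open>P\<close> makes sense on both sides
    of 0.\<close>
  define P where "P = (\<lambda>x. LBINT t=(0::real)..x. v t)"
  have int: "interval_lebesgue_integrable lborel (ereal a) (ereal b) v" if "a \<le> b" for a b
    using that by (auto simp: interval_lebesgue_integrable_def intro!: set_integrable_subset[OF v[of a b]])
  have diff: "P y - P x = (LINT t:{x..y}|lborel. v t)" if "x \<le> y" for x y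
  proof -
    have *: "min (ereal 0) (min (ereal x) (ereal y)) = ereal (min 0 (min x y))" "max (ereal 0) (max (ereal x) (ereal y)) = ereal (max 0 (max x y))"
      by (auto simp: min_def max_def)
    have "interval_lebesgue_integrable lborel (min (ereal 0) (min (ereal x) (ereal y))) (max (ereal 0) (max (ereal x) (ereal y))) v"
      unfolding * by (rule int) simp
    then have "P x + (LBINT t=x..y. v t) = P y"
      unfolding P_def by (rule interval_integral_sum)
    moreover have "(LBINT t=x..y. v t) = (LINT t:{x..y}|lborel. v t)"
      by (rule interval_integral_Icc[OF that])
    ultimately show ?thesis by (metis add_diff_cancel_left')
  qed
  \<comment> \<open>On \<open>[-n, n]\<close> the function \<open>P\<close> is a constant plus an
    indefinite integral, hence continuous; the interiors form an open cover of the line.\<close>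
  have "continuous_on {-real n<..<real n} P" for n
  proof (rule continuous_on_subset)
    have "v integrable_on {-real n..real n}" using v set_borel_integral_eq_integral(1) by blast
    then have "continuous_on {-real n..real n} (\<lambda>x. P (- real n) + integral {-real n..x} v)"
      by (intro continuous_intros indefinite_integral_continuous_1)
    moreover have "P (- real n) + integral {-real n..x} v = P x" if "x \<in> {-real n..real n}" for x
      using diff[of "- real n" x] that set_borel_integral_eq_integral(2)[OF v, of "- real n" x]
      by (simp add: algebra_simps)
    ultimately show "continuous_on {-real n..real n} P" by (metis (no_types, lifting) continuous_on_cong)
  qed auto
  then have "continuous_on (\<Union>n. {-real n<..<real n}) P"
    by (intro continuous_on_open_UN) auto
  moreover have "(\<Union>n. {-real n<..<real n}) = UNIV"
  proof (intro equalityI subsetI)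
    fix x :: real
    obtain n where "\<bar>x\<bar> < real n" using reals_Archimedean2 by blast
    then show "x \<in> (\<Union>n. {-real n<..<real n})" by (auto intro!: exI[of _ n])
  qed simp
  ultimately show ?thesis using that diff by simp
qed

lemma L1_loc_borel_rep:
  assumes "u \<in> L1_loc"
  obtains u0 where "u0 \<in> borel_measurable borel" "AE x in lebesgue. u0 x = u x"
    "\<And>a b. set_integrable lborel {a..b} u0"
proof -
  have um[measurable]: "u \<in> borel_measurable lebesgue" using assms by (simp add: L1_loc_def)
  obtain u0 where u0: "u0 \<in> borel_measurable borel" "AE x in lebesgue. u0 x = u x"
    using lebesgue_measurable_borel_rep[OF um] by blast
  note u0(1)[measurable]
  have "set_integrable lborel {a..b} u0" for a b
  proof -
    have "integrable lebesgue (\<lambda>x. indicator {a..b} x *\<^sub>R u x)"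
      using assms by (simp add: L1_loc_def set_integrable_def)
    moreover have "(\<lambda>x. indicator {a..b} x *\<^sub>R u0 x) \<in> borel_measurable lebesgue"
      by (rule measurable_completion) simp
    ultimately have "integrable lebesgue (\<lambda>x. indicator {a..b} x *\<^sub>R u0 x)"
      by (rule integrable_cong_AE_imp) (use u0(2) in \<open>auto elim!: eventually_mono\<close>)
    then show ?thesis
      unfolding set_integrable_def by (subst (asm) integrable_completion) auto
  qed
  with u0 show ?thesis using that by blast
qed

lemma integral_lebesgue_borel_rep:
  fixes u u0 :: "real \<Rightarrow> 'a::euclidean_space"
  assumes "u \<in> borel_measurable lebesgue" "u0 \<in> borel_measurable borel" "AE x in lebesgue. u0 x = u x"
    and \<phi>: "continuous_on UNIV \<phi>"
  shows "(LINT x|lebesgue. \<phi> x *\<^sub>R u x) = (LINT x|lborel. \<phi> x *\<^sub>R u0 x)"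
proof -
  note assms(1,2)[measurable]
  have [measurable]: "\<phi> \<in> borel_measurable borel" using \<phi> by (rule borel_measurable_continuous_onI)
  have meas: "(\<lambda>x. \<phi> x *\<^sub>R u0 x) \<in> borel_measurable lborel" by simp
  have [measurable]: "\<phi> \<in> borel_measurable lebesgue" by (intro measurable_completion) simp
  have "(LINT x|lebesgue. \<phi> x *\<^sub>R u x) = (LINT x|lebesgue. \<phi> x *\<^sub>R u0 x)"
    by (rule integral_cong_AE) (use assms(3) measurable_completion[OF meas] in \<open>auto elim!: eventually_mono\<close>)
  also have "\<dots> = (LINT x|lborel. \<phi> x *\<^sub>R u0 x)"
    by (rule integral_completion[OF meas])
  finally show ?thesis .
qed

text \<open>Let \<open>P\<close> be a primitive of a Borel representative of \<open>v\<close>. By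
  parts, \<open>u - P\<close> is annihilated by every \<open>deriv \<phi>\<close>, so it is a.e. a
  constant \<open>c\<close>, and \<open>w = P + c\<close>.\<close>

lemma weak_deriv_representation:
  assumes uv: "has_weak_deriv u v"
  obtains w v0 where "continuous_on UNIV w" "AE z in lebesgue. w z = u z"
    "v0 \<in> borel_measurable borel" "AE z in lebesgue. v0 z = v z"
    "\<And>a b. set_integrable lborel {a..b} v0"
    "\<And>x y. x \<le> y \<Longrightarrow> w y - w x = (LINT t:{x..y}|lborel. v0 t)"
proof -
  have L1: "u \<in> L1_loc" "v \<in> L1_loc" using uv by (auto simp: has_weak_deriv_def)
  obtain u0 where u0: "u0 \<in> borel_measurable borel" "AE x in lebesgue. u0 x = u x"
    "\<And>a b. set_integrable lborel {a..b} u0" using L1_loc_borel_rep[OF L1(1)] by blast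
  obtain v0 where v0: "v0 \<in> borel_measurable borel" "AE x in lebesgue. v0 x = v x"
    "\<And>a b. set_integrable lborel {a..b} v0" using L1_loc_borel_rep[OF L1(2)] by blast
  obtain P where P: "continuous_on UNIV P" "\<And>x y. x \<le> y \<Longrightarrow> P y - P x = (LINT t:{x..y}|lborel. v0 t)"
    using primitive_exists[OF v0(3)] by blast
  have Pint: "set_integrable lborel {a..b} P" for a b
    by (intro borel_integrable_atLeastAtMost' continuous_on_subset[OF P(1)]) simp
  have Pm: "P \<in> borel_measurable borel" using P(1) by (rule borel_measurable_continuous_onI)
  obtain c where c: "AE x in lborel. u0 x - P x = c"
  proof (rule du_Bois_Reymond)
    show "set_integrable lborel {a..b} (\<lambda>x. u0 x - P x)" for a b
      using u0(3) Pint by (rule set_integral_diff)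
    show "(\<lambda>x. u0 x - P x) \<in> borel_measurable borel" using u0(1) Pm by simp
    fix \<phi> assume \<phi>: "test_fun \<phi>"
    have cont: "continuous_on UNIV \<phi>" "continuous_on UNIV (deriv \<phi>)"
      using smooth_continuous smooth_deriv test_fun_smooth[OF \<phi>] by blast+
    obtain a b where ab: "\<And>x. x \<notin> {a<..<b} \<Longrightarrow> \<phi> x = 0" using test_fun_support[OF \<phi>] by blast
    have sup: "deriv \<phi> x = 0" if "x \<notin> {a..b}" for x using test_fun_deriv_support[OF \<phi> ab that] .
    have "(LINT x|lborel. deriv \<phi> x *\<^sub>R u0 x) = - (LINT x|lborel. \<phi> x *\<^sub>R v0 x)"
      using uv \<phi> L1 integral_lebesgue_borel_rep[OF _ u0(1,2) cont(2)] integral_lebesgue_borel_rep[OF _ v0(1,2) cont(1)]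
      by (simp add: has_weak_deriv_def L1_loc_def)
    also have "\<dots> = (LINT x|lborel. deriv \<phi> x *\<^sub>R P x)"
      using integral_by_parts_test_fun[OF \<phi> v0(3,1) P] by simp
    finally have "(LINT x|lborel. deriv \<phi> x *\<^sub>R u0 x) = (LINT x|lborel. deriv \<phi> x *\<^sub>R P x)" .
    moreover have "integrable lborel (\<lambda>x. deriv \<phi> x *\<^sub>R u0 x)" "integrable lborel (\<lambda>x. deriv \<phi> x *\<^sub>R P x)"
      using integrable_scaleR_of_compact_support[OF u0(3,1) cont(2) sup]
        integrable_scaleR_of_compact_support[OF Pint Pm cont(2) sup] by blast+
    ultimately show "(LINT x|lborel. deriv \<phi> x *\<^sub>R (u0 x - P x)) = 0"
      by (simp add: scaleR_diff_right)
  qed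
  show ?thesis
  proof (rule that[of "\<lambda>x. P x + c" v0])
    show "AE z in lebesgue. P z + c = u z"
      using AE_completion[OF c] u0(2) by eventually_elim auto
  qed (use P v0 in \<open>auto intro!: continuous_intros\<close>)
qed

text \<open>The set where two continuous candidates differ is open and null, hence empty; so the
  \<open>THE\<close> in \<open>cont_rep\<close> picks any candidate that is exhibited.\<close>

lemma cont_rep_eq:
  assumes w: "continuous_on UNIV w" "AE z in lebesgue. w z = u z"
  shows "cont_rep u = w"
  unfolding cont_rep_def
proof (rule the_equality)
  fix w' assume w': "continuous_on UNIV w' \<and> (AE z in lebesgue. w' z = u z)"
  have "open {z. w' z \<noteq> w z}"
    using w w' by (intro open_Collect_neq) auto
  moreover have "AE z in lebesgue. z \<notin> {z. w' z \<noteq> w z}"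
    using w(2) conjunct2[OF w'] by eventually_elim simp
  then have "{z. w' z \<noteq> w z} \<in> null_sets lebesgue"
    using \<open>open {z. w' z \<noteq> w z}\<close> by (subst AE_iff_null_sets) auto
  then have "negligible {z. w' z \<noteq> w z}" by (simp add: negligible_iff_null_sets)
  ultimately have "{z. w' z \<noteq> w z} = {}" using open_not_negligible by blast
  then show "w' = w" by auto
qed (use w in simp)

section \<open>Energy estimates\<close>

text \<open>On a monotone branch \<open>r\<close> has constant sign a.e., so the integral of
  \<open>|r|\<close> over \<open>[x,y]\<close> is the net change \<open>|R y - R x|\<close>, which
  is the bound \<open>var\<close> required for the upper comparison.\<close>

lemma nn_integral_ge_monotone_primitive:
  fixes R r :: "real \<Rightarrow> real" and G :: "real \<Rightarrow> ennreal"
  assumes R: "continuous_on UNIV R" and rm[measurable]: "r \<in> borel_measurable borel"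
    and r: "\<And>a b. set_integrable lborel {a..b} r"
    and prim: "\<And>x y. x \<le> y \<Longrightarrow> R y - R x = (LINT t:{x..y}|lborel. r t)"
    and G: "G \<in> borel_measurable borel"
    and mono: "mono_on {a..b} R \<or> antimono_on {a..b} R"
    and range: "R ` {a..b} \<subseteq> {l..u}"
  shows "(\<integral>\<^sup>+z\<in>{a..b}. G (R z) * ennreal \<bar>r z\<bar> \<partial>lborel) \<le> (\<integral>\<^sup>+s\<in>{l..u}. G s \<partial>lborel)"
proof (rule nn_integral_ge_monotone[OF R _ G _ range])
  show "(\<lambda>z. ennreal \<bar>r z\<bar>) \<in> borel_measurable borel" by simp
  fix x y assume xy: "a \<le> x" "x \<le> y" "y \<le> b"
  \<comment> \<open>\<open>\<sigma>\<close> is 1 on an increasing branch and -1 on a decreasing one,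
    so both reduce to \<open>0 \<le> \<sigma> * r z\<close>.\<close>
  obtain \<sigma> :: real where \<sigma>: "\<bar>\<sigma>\<bar> = 1"
    "\<And>x y. a \<le> x \<Longrightarrow> x \<le> y \<Longrightarrow> y \<le> b \<Longrightarrow> 0 \<le> \<sigma> * (R y - R x)"
  proof (cases "mono_on {a..b} R")
    case True
    show ?thesis by (rule that[of 1]) (use True in \<open>auto simp: monotone_on_def\<close>)
  next
    case False
    with mono have "antimono_on {a..b} R" by simp
    then show ?thesis by (intro that[of "-1"]) (auto simp: monotone_on_def)
  qed
  have int: "set_integrable lborel {p..q} (\<lambda>z. \<sigma> * r z)" for p q
    using r by simp
  have eq: "(LINT z:{p..q}|lborel. \<sigma> * r z) = \<sigma> * (R q - R p)" if "p \<le> q" for p q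
    using prim[OF that] by simp
  have ae: "AE z in lborel. z \<in> {a..b} \<longrightarrow> 0 \<le> \<sigma> * r z"
    by (rule AE_nonneg_if_integral_nonneg[OF int]) (simp, subst eq, simp, intro \<sigma>(2))
  have abs_r: "\<bar>r z\<bar> = \<sigma> * r z" if "0 \<le> \<sigma> * r z" for z
    using that \<sigma>(1) by (metis abs_mult abs_of_nonneg mult_1)
  have "(\<integral>\<^sup>+z\<in>{x..y}. ennreal \<bar>r z\<bar> \<partial>lborel) = (\<integral>\<^sup>+z. ennreal (indicator {x..y} z *\<^sub>R (\<sigma> * r z)) \<partial>lborel)"
    by (intro nn_integral_cong_AE) (use ae xy abs_r in \<open>auto elim!: eventually_mono simp: indicator_def\<close>)
  also have "\<dots> = ennreal (LINT z:{x..y}|lborel. \<sigma> * r z)"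
    unfolding set_lebesgue_integral_def
    by (rule nn_integral_eq_integral)
      (use int[of x y] ae xy in \<open>auto elim!: eventually_mono simp: set_integrable_def indicator_def\<close>)
  also have "\<dots> \<le> ennreal \<bar>R y - R x\<bar>"
    unfolding eq[OF xy(2)] using \<sigma>(1) by (intro ennreal_leI) (metis abs_ge_self abs_mult mult_1)
  finally show "(\<integral>\<^sup>+z\<in>{x..y}. ennreal \<bar>r z\<bar> \<partial>lborel) \<le> ennreal \<bar>R y - R x\<bar>" .
qed

lemma nn_integral_le_Icc_bound:
  fixes f :: "real \<Rightarrow> ennreal"
  assumes [measurable]: "f \<in> borel_measurable borel"
    and le: "\<And>n. (\<integral>\<^sup>+z\<in>{c - real n..c + real n}. f z \<partial>lborel) \<le> K"
  shows "(\<integral>\<^sup>+z. f z \<partial>lborel) \<le> K"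
proof -
  have "(\<integral>\<^sup>+z. (SUP n. f z * indicator {c - real n..c + real n} z) \<partial>lborel)
      = (SUP n. \<integral>\<^sup>+z\<in>{c - real n..c + real n}. f z \<partial>lborel)"
    by (rule nn_integral_monotone_convergence_SUP) (auto simp: incseq_def le_fun_def indicator_def)
  moreover have "(SUP n. f z * indicator {c - real n..c + real n} z) = f z" for z
  proof (rule antisym)
    obtain n where "\<bar>z - c\<bar> < real n" using reals_Archimedean2 by blast
    then have "f z = f z * indicator {c - real n..c + real n} z" by (auto simp: indicator_def)
    then show "f z \<le> (SUP n. f z * indicator {c - real n..c + real n} z)"
      by (metis (mono_tags, lifting) UNIV_I SUP_upper)
  qed (auto intro!: SUP_least simp: indicator_def)
  ultimately show ?thesis using le by (auto intro!: SUP_least)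
qed

text \<open>Recovers the full band from the bands bounded away from 0, the only ones certain to be
  crossed on a compact interval.\<close>

lemma nn_integral_Ioo_eq_SUP:
  fixes f :: "real \<Rightarrow> ennreal"
  assumes [measurable]: "f \<in> borel_measurable borel"
  shows "(\<integral>\<^sup>+s\<in>{0<..<d}. f s \<partial>lborel) = (SUP n. \<integral>\<^sup>+s\<in>{1 / Suc n<..<d}. f s \<partial>lborel)"
proof -
  have "(\<integral>\<^sup>+s. (SUP n. f s * indicator {1 / Suc n<..<d} s) \<partial>lborel)
      = (SUP n. \<integral>\<^sup>+s\<in>{1 / Suc n<..<d}. f s \<partial>lborel)"
  proof (rule nn_integral_monotone_convergence_SUP)
    show "incseq (\<lambda>n s. f s * indicator {1 / Suc n<..<d} s)"
    proof (intro incseq_SucI le_funI mult_left_mono)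
      fix n s
      have "1 / real (Suc (Suc n)) \<le> 1 / real (Suc n)" by (simp add: field_simps)
      then show "indicator {1 / Suc n<..<d} s \<le> (indicator {1 / Suc (Suc n)<..<d} s :: ennreal)"
        by (auto simp: indicator_def simp del: of_nat_Suc)
    qed simp
  qed simp
  moreover have "(SUP n. f s * indicator {1 / Suc n<..<d} s) = f s * indicator {0<..<d} s" for s
  proof (rule antisym)
    show "f s * indicator {0<..<d} s \<le> (SUP n. f s * indicator {1 / Suc n<..<d} s)"
    proof (cases "s \<in> {0<..<d}")
      case True
      then obtain n where "1 / real (Suc n) < s"
        using nat_approx_posE[of s] by auto
      with True have "f s * indicator {0<..<d} s = f s * indicator {1 / Suc n<..<d} s"
        by (simp add: indicator_def)
      then show ?thesis by (metis (mono_tags, lifting) UNIV_I SUP_upper)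
    qed simp
  next
    have "f s * indicator {1 / Suc n<..<d} s \<le> f s * indicator {0<..<d} s" for n
    proof (intro mult_left_mono)
      have pos: "0 < 1 / real (Suc n)" by simp
      show "indicator {1 / Suc n<..<d} s \<le> (indicator {0<..<d} s :: ennreal)"
        by (auto simp: indicator_def simp del: of_nat_Suc intro: less_trans[OF pos])
    qed simp
    then show "(SUP n. f s * indicator {1 / Suc n<..<d} s) \<le> f s * indicator {0<..<d} s"
      by (rule SUP_least)
  qed
  ultimately show ?thesis by simp
qed

lemma infdist_diff_le: "\<bar>infdist x A - infdist y A\<bar> \<le> dist x y"
  using infdist_triangle[of x A y] infdist_triangle[of y A x] by (auto simp: dist_commute abs_le_iff)

text \<open>The way from one well to the other leads through \<open>q\<close>. At equal distances,
  each is therefore at least half the separation.\<close>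

lemma setdist_le_infdist_sum:
  fixes A B :: "'a::euclidean_space set"
  assumes "closed A" "A \<noteq> {}" "closed B" "B \<noteq> {}"
  shows "setdist A B \<le> infdist q A + infdist q B"
proof -
  obtain a where a: "a \<in> A" "infdist q A = dist q a" using infdist_attains_inf[OF assms(1,2)] by blast
  obtain b where b: "b \<in> B" "infdist q B = dist q b" using infdist_attains_inf[OF assms(3,4)] by blast
  have "setdist A B \<le> dist a b" using a b by (intro setdist_le_dist)
  also have "\<dots> \<le> dist q a + dist q b" by (rule dist_triangle3)
  finally show ?thesis using a b by simp
qed

section \<open>Energy bounds for a scalar function on the line\<close>

text \<open>The price of one crossing: in the band,
  \<open>2 sqrt (g R) |v| \<le> |v|^2 + g R \<le> |v|^2 + W\<close>, and the crossing inequality is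
  applied with \<open>m = norm v\<close>. Here \<open>W\<close> is already the potential along the
  curve.\<close>

lemma energy_ge_crossing:
  fixes R W :: "real \<Rightarrow> real" and v :: "real \<Rightarrow> 'a::euclidean_space" and g :: "real \<Rightarrow> real"
  assumes R: "continuous_on UNIV R" and vm[measurable]: "v \<in> borel_measurable borel"
    and v: "\<And>a b. set_integrable lborel {a..b} v"
    and lip: "\<And>x y. x \<le> y \<Longrightarrow> \<bar>R y - R x\<bar> \<le> norm (LINT t:{x..y}|lborel. v t)"
    and G: "(\<lambda>s. ennreal (sqrt (g s)) * indicator {0..<d} s) \<in> borel_measurable borel"
    and Wm[measurable]: "W \<in> borel_measurable borel" and W: "\<And>z. 0 \<le> W z"
    and g: "\<And>s. s \<in> {0..<d} \<Longrightarrow> 0 \<le> g s"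
    and Wg: "\<And>z. R z < d \<Longrightarrow> g (R z) \<le> W z"
    and "a \<le> b" "0 \<le> \<epsilon>" "min (R a) (R b) \<le> \<epsilon>" "d \<le> max (R a) (R b)"
  shows "2 * (\<integral>\<^sup>+s\<in>{\<epsilon><..<d}. ennreal (sqrt (g s)) * indicator {0..<d} s \<partial>lborel)
    \<le> (\<integral>\<^sup>+z\<in>{a..b}. ennreal ((norm (v z))\<^sup>2 + W z) \<partial>lborel)"
proof -
  let ?G = "\<lambda>s. ennreal (sqrt (g s)) * indicator {0..<d} s"
  have [measurable]: "R \<in> borel_measurable borel" using R by (rule borel_measurable_continuous_onI)
  note G[measurable]
  have norm_eq: "(\<integral>\<^sup>+z\<in>{x..y}. ennreal (norm (v z)) \<partial>lborel) = (\<integral>\<^sup>+z. ennreal (norm (indicator {x..y} z *\<^sub>R v z)) \<partial>lborel)" for x y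
    by (intro nn_integral_cong) (auto simp: indicator_def)
  have "2 * (\<integral>\<^sup>+s\<in>{\<epsilon><..<d}. ?G s \<partial>lborel)
      \<le> 2 * (\<integral>\<^sup>+z\<in>{a..b}. (?G (R z) * indicator {\<epsilon><..<d} (R z)) * ennreal (norm (v z)) \<partial>lborel)"
  proof (intro mult_left_mono nn_integral_le_crossing[OF R _ G])
    show "(\<integral>\<^sup>+z\<in>{a..b}. ennreal (norm (v z)) \<partial>lborel) < \<infinity>"
      unfolding norm_eq using v[of a b] unfolding set_integrable_def integrable_iff_bounded by simp
    show "ennreal \<bar>R y - R x\<bar> \<le> (\<integral>\<^sup>+z\<in>{x..y}. ennreal (norm (v z)) \<partial>lborel)" if "x \<le> y" for x y
    proof -
      have "ennreal \<bar>R y - R x\<bar> \<le> ennreal (norm (LINT t:{x..y}|lborel. v t))"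
        using lip[OF that] by (rule ennreal_leI)
      also have "\<dots> \<le> (\<integral>\<^sup>+z. ennreal (norm (indicator {x..y} z *\<^sub>R v z)) \<partial>lborel)"
        unfolding set_lebesgue_integral_def
        using v[of x y] unfolding set_integrable_def by (rule integral_norm_bound_ennreal)
      finally show ?thesis unfolding norm_eq .
    qed
  qed (use assms in simp_all)
  also have "\<dots> = (\<integral>\<^sup>+z. 2 * ((?G (R z) * indicator {\<epsilon><..<d} (R z)) * ennreal (norm (v z)) * indicator {a..b} z) \<partial>lborel)"
    by (rule nn_integral_cmult[symmetric]) simp
  also have "\<dots> \<le> (\<integral>\<^sup>+z\<in>{a..b}. ennreal ((norm (v z))\<^sup>2 + W z) \<partial>lborel)"
  proof (rule nn_integral_mono)
    fix z
    show "2 * ((?G (R z) * indicator {\<epsilon><..<d} (R z)) * ennreal (norm (v z)) * indicator {a..b} z)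
        \<le> ennreal ((norm (v z))\<^sup>2 + W z) * indicator {a..b} z"
    proof (cases "R z \<in> {\<epsilon><..<d} \<and> z \<in> {a..b}")
      case True
      then have Rz: "R z \<in> {0..<d}" using \<open>0 \<le> \<epsilon>\<close> by auto
      have "2 * (sqrt (g (R z)) * norm (v z)) \<le> (norm (v z))\<^sup>2 + (sqrt (g (R z)))\<^sup>2"
        using sum_squares_bound[of "norm (v z)" "sqrt (g (R z))"] by (simp add: mult_ac)
      also have "\<dots> \<le> (norm (v z))\<^sup>2 + W z"
        using g[OF Rz] Wg[of z] Rz by simp
      finally have "ennreal (2 * (sqrt (g (R z)) * norm (v z))) \<le> ennreal ((norm (v z))\<^sup>2 + W z)"
        by (rule ennreal_leI)
      moreover have "ennreal (2 * (sqrt (g (R z)) * norm (v z))) = 2 * (ennreal (sqrt (g (R z))) * ennreal (norm (v z)))"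
        using g[OF Rz] by (simp add: ennreal_mult)
      ultimately show ?thesis using True Rz by simp
    qed (auto simp: indicator_def)
  qed
  finally show ?thesis .
qed

text \<open>The band is crossed once on each side of \<open>z0\<close>; the two compact intervals
  share only the point \<open>z0\<close>, so the costs add.\<close>

lemma energy_ge_double_crossing:
  fixes R W :: "real \<Rightarrow> real" and v :: "real \<Rightarrow> 'a::euclidean_space" and g :: "real \<Rightarrow> real"
  assumes R: "continuous_on UNIV R" and vm[measurable]: "v \<in> borel_measurable borel"
    and v: "\<And>a b. set_integrable lborel {a..b} v"
    and lip: "\<And>x y. x \<le> y \<Longrightarrow> \<bar>R y - R x\<bar> \<le> norm (LINT t:{x..y}|lborel. v t)"
    and G: "(\<lambda>s. ennreal (sqrt (g s)) * indicator {0..<d} s) \<in> borel_measurable borel"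
    and Wm[measurable]: "W \<in> borel_measurable borel" and W: "\<And>z. 0 \<le> W z"
    and g: "\<And>s. s \<in> {0..<d} \<Longrightarrow> 0 \<le> g s"
    and Wg: "\<And>z. R z < d \<Longrightarrow> g (R z) \<le> W z"
    and bot: "(R \<longlongrightarrow> 0) at_bot" and top: "(R \<longlongrightarrow> 0) at_top" and top_level: "d \<le> R z0"
  shows "4 * (\<integral>\<^sup>+s\<in>{0..<d}. ennreal (sqrt (g s)) \<partial>lborel)
    \<le> (\<integral>\<^sup>+z. ennreal ((norm (v z))\<^sup>2 + W z) \<partial>lborel)"
proof -
  let ?G = "\<lambda>s. ennreal (sqrt (g s)) * indicator {0..<d} s"
  let ?E = "\<lambda>z. ennreal ((norm (v z))\<^sup>2 + W z)"
  have bound: "4 * (\<integral>\<^sup>+s\<in>{\<epsilon><..<d}. ?G s \<partial>lborel) \<le> (\<integral>\<^sup>+z. ?E z \<partial>lborel)" if "\<epsilon> > 0" for \<epsilon>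
  proof -
    have "\<forall>\<^sub>F z in at_bot. R z < \<epsilon>" "\<forall>\<^sub>F z in at_top. R z < \<epsilon>"
      using order_tendstoD(2)[OF bot that] order_tendstoD(2)[OF top that] .
    then obtain a b where ab: "\<And>z. z \<le> a \<Longrightarrow> R z < \<epsilon>" "\<And>z. z \<ge> b \<Longrightarrow> R z < \<epsilon>"
      unfolding eventually_at_bot_linorder eventually_at_top_linorder by blast
    \<comment> \<open>\<open>min\<close> and \<open>max\<close> keep
      \<open>a' \<le> z0 \<le> b'\<close> whatever the order of \<open>a\<close>, \<open>b\<close>
      and \<open>z0\<close>; smallness of \<open>R\<close> persists further out.\<close>
    define a' b' where "a' = min a z0" and "b' = max b z0"
    have ab': "a' \<le> z0" "z0 \<le> b'" "R a' \<le> \<epsilon>" "R b' \<le> \<epsilon>"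
      using ab(1)[of a'] ab(2)[of b'] by (auto simp: a'_def b'_def)
    have "2 * (\<integral>\<^sup>+s\<in>{\<epsilon><..<d}. ?G s \<partial>lborel) \<le> (\<integral>\<^sup>+z\<in>{a'..z0}. ?E z \<partial>lborel)"
      using ab' that top_level
      by (intro energy_ge_crossing[where R = R] R vm v lip G Wm W g Wg) auto
    moreover have "2 * (\<integral>\<^sup>+s\<in>{\<epsilon><..<d}. ?G s \<partial>lborel) \<le> (\<integral>\<^sup>+z\<in>{z0..b'}. ?E z \<partial>lborel)"
      using ab' that top_level
      by (intro energy_ge_crossing[where R = R] R vm v lip G Wm W g Wg) auto
    ultimately have "2 * (\<integral>\<^sup>+s\<in>{\<epsilon><..<d}. ?G s \<partial>lborel) + 2 * (\<integral>\<^sup>+s\<in>{\<epsilon><..<d}. ?G s \<partial>lborel)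
        \<le> (\<integral>\<^sup>+z\<in>{a'..z0}. ?E z \<partial>lborel) + (\<integral>\<^sup>+z\<in>{z0..b'}. ?E z \<partial>lborel)"
      by (rule add_mono)
    also have "\<dots> = (\<integral>\<^sup>+z. ?E z * indicator {a'..z0} z + ?E z * indicator {z0..b'} z \<partial>lborel)"
      by (rule nn_integral_add[symmetric]) auto
    also have "\<dots> \<le> (\<integral>\<^sup>+z. ?E z \<partial>lborel)"
      by (rule nn_integral_mono_AE)
        (use AE_lborel_singleton[of z0] in \<open>auto elim!: eventually_mono simp: indicator_def\<close>)
    finally show ?thesis by (simp add: distrib_right[symmetric])
  qed
  have "(\<integral>\<^sup>+s\<in>{0..<d}. ennreal (sqrt (g s)) \<partial>lborel) = (\<integral>\<^sup>+s\<in>{0<..<d}. ?G s \<partial>lborel)"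
    by (rule nn_integral_cong_AE)
      (use AE_lborel_singleton[of "0::real"] in \<open>auto elim!: eventually_mono simp: indicator_def\<close>)
  also have "\<dots> = (SUP n. \<integral>\<^sup>+s\<in>{1 / Suc n<..<d}. ?G s \<partial>lborel)"
    using G by (rule nn_integral_Ioo_eq_SUP)
  finally have "4 * (\<integral>\<^sup>+s\<in>{0..<d}. ennreal (sqrt (g s)) \<partial>lborel)
      = (SUP n. 4 * (\<integral>\<^sup>+s\<in>{1 / Suc n<..<d}. ?G s \<partial>lborel))"
    by (simp add: SUP_mult_left_ennreal del: of_nat_Suc)
  also have "\<dots> \<le> (\<integral>\<^sup>+z. ?E z \<partial>lborel)"
    by (rule SUP_least, rule bound) simp
  finally show ?thesis .
qed

text \<open>The pointwise inequalities become equalities: off the null level set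
  \<open>|v|^2 = W = g R\<close> and \<open>|v| = |r|\<close>, so the energy density is
  \<open>2 sqrt (g R) |r|\<close>. Each monotone branch then contributes at most twice the integral
  of \<open>sqrt g\<close>.\<close>

lemma energy_le_monotone_transition:
  fixes R r W :: "real \<Rightarrow> real" and v :: "real \<Rightarrow> 'a::euclidean_space" and g :: "real \<Rightarrow> real"
  assumes R: "continuous_on UNIV R" and rm[measurable]: "r \<in> borel_measurable borel"
    and r: "\<And>a b. set_integrable lborel {a..b} r"
    and prim: "\<And>x y. x \<le> y \<Longrightarrow> R y - R x = (LINT t:{x..y}|lborel. r t)"
    and G: "(\<lambda>s. ennreal (sqrt (g s)) * indicator {0..<d} s) \<in> borel_measurable borel"
    and R0: "\<And>z. 0 \<le> R z"
    and mono: "R z0 = d" "mono_on {..z0} R" "antimono_on {z0..} R"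
    and Wg: "AE z in lborel. R z < d \<longrightarrow> W z = g (R z)"
    and eqp: "AE z in lborel. (norm (v z))\<^sup>2 = W z"
    and eik: "AE z in lborel. \<bar>r z\<bar> = norm (v z)"
    and level: "AE z in lborel. R z \<noteq> d"
  shows "(\<integral>\<^sup>+z. ennreal ((norm (v z))\<^sup>2 + W z) \<partial>lborel)
    \<le> 4 * (\<integral>\<^sup>+s\<in>{0..<d}. ennreal (sqrt (g s)) \<partial>lborel)"
proof -
  let ?G = "\<lambda>s. ennreal (sqrt (g s)) * indicator {0..<d} s"
  let ?I = "\<integral>\<^sup>+s\<in>{0..<d}. ennreal (sqrt (g s)) \<partial>lborel"
  let ?f = "\<lambda>z. ?G (R z) * ennreal \<bar>r z\<bar>"
  have Rm[measurable]: "R \<in> borel_measurable borel" using R by (rule borel_measurable_continuous_onI)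
  have GR[measurable]: "(\<lambda>z. ?G (R z)) \<in> borel_measurable borel"
    using measurable_compose[OF Rm G] .
  have f[measurable]: "?f \<in> borel_measurable borel" by (rule borel_measurable_times_ennreal[OF GR]) simp
  \<comment> \<open>The peak value bounds \<open>R\<close>; together with \<open>level\<close> this
    gives \<open>R z < d\<close> a.e., the region in which \<open>Wg\<close> speaks.\<close>
  have Rd: "R z \<le> d" for z
    using mono by (cases "z \<le> z0") (auto simp: monotone_on_def)
  \<comment> \<open>Closing the interval at \<open>d\<close> is harmless because the indicator in
    \<open>?G\<close> vanishes there.\<close>
  have I: "(\<integral>\<^sup>+s\<in>{0..d}. ?G s \<partial>lborel) = ?I"
    by (intro nn_integral_cong) (auto simp: indicator_def)
  have half: "(\<integral>\<^sup>+z\<in>{a..b}. ?f z \<partial>lborel) \<le> ?I" if "b \<le> z0 \<or> z0 \<le> a" for a b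
  proof -
    have m: "mono_on {a..b} R \<or> antimono_on {a..b} R"
      using that
    proof
      assume "b \<le> z0"
      then have "{a..b} \<subseteq> {..z0}" by auto
      with mono(2) show ?thesis by (blast intro: monotone_on_subset)
    next
      assume "z0 \<le> a"
      then have "{a..b} \<subseteq> {z0..}" by auto
      with mono(3) show ?thesis by (blast intro: monotone_on_subset)
    qed
    have "R ` {a..b} \<subseteq> {0..d}" using R0 Rd by auto
    from m this have "(\<integral>\<^sup>+z\<in>{a..b}. ?f z \<partial>lborel) \<le> (\<integral>\<^sup>+s\<in>{0..d}. ?G s \<partial>lborel)"
      by (intro nn_integral_ge_monotone_primitive[where G = ?G, OF R rm r prim G])
    then show ?thesis unfolding I .
  qed
  have "(\<integral>\<^sup>+z\<in>{z0 - real n..z0 + real n}. ?f z \<partial>lborel) \<le> 2 * ?I" for n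
  proof -
    have "(\<integral>\<^sup>+z\<in>{z0 - real n..z0 + real n}. ?f z \<partial>lborel)
        \<le> (\<integral>\<^sup>+z. ?f z * indicator {z0 - real n..z0} z + ?f z * indicator {z0..z0 + real n} z \<partial>lborel)"
      by (rule nn_integral_mono) (auto simp: indicator_def)
    also have "\<dots> = (\<integral>\<^sup>+z\<in>{z0 - real n..z0}. ?f z \<partial>lborel) + (\<integral>\<^sup>+z\<in>{z0..z0 + real n}. ?f z \<partial>lborel)"
      by (rule nn_integral_add) (use borel_measurable_times_ennreal[OF f] in simp_all)
    also have "\<dots> \<le> ?I + ?I" by (intro add_mono half) auto
    finally show ?thesis by (simp add: mult_2)
  qed
  then have le: "(\<integral>\<^sup>+z. ?f z \<partial>lborel) \<le> 2 * ?I" by (rule nn_integral_le_Icc_bound[OF f])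
  have "(\<integral>\<^sup>+z. ennreal ((norm (v z))\<^sup>2 + W z) \<partial>lborel) = (\<integral>\<^sup>+z. 2 * ?f z \<partial>lborel)"
  proof (rule nn_integral_cong_AE)
    show "AE z in lborel. ennreal ((norm (v z))\<^sup>2 + W z) = 2 * ?f z"
      using Wg eqp eik level
    proof eventually_elim
      case (elim z)
      then have "R z < d" using Rd[of z] by simp
      with elim have "(norm (v z))\<^sup>2 = g (R z)" by simp
      then have "sqrt (g (R z)) = norm (v z)" by (metis norm_ge_zero real_sqrt_unique)
      moreover have "(norm (v z))\<^sup>2 + W z = 2 * (norm (v z) * norm (v z))"
        using elim by (simp add: power2_eq_square)
      ultimately show ?case
        using \<open>R z < d\<close> R0[of z] elim(3) by (simp add: ennreal_mult)
    qed
  qed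
  also have "\<dots> = 2 * (\<integral>\<^sup>+z. ?f z \<partial>lborel)" by (rule nn_integral_cmult) (use f in simp)
  also have "\<dots> \<le> 2 * (2 * ?I)" using le by (intro mult_left_mono) auto
  finally show ?thesis by (simp add: mult.assoc[symmetric])
qed

section \<open>Reduction of the vector-valued problem to the scalar one\<close>

text \<open>Everything reduces to \<open>R = \<rho> \<circ> w\<close> with \<open>w\<close> the
  continuous representative. Increase and decrease are rendered as weak monotonicity on the two
  sides of a peak \<open>z0\<close>, and the derivative of \<open>\<rho> \<circ> \<Psi>\<close> as a
  weak derivative \<open>r\<close>.\<close>

theorem proposition11:
  fixes Sm Sp :: "'a::euclidean_space set"
    and D :: real
    and \<rho> W :: "'a \<Rightarrow> real"
    and g :: "real \<Rightarrow> real"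
    and \<Psi> \<Psi>' :: "real \<Rightarrow> 'a"
  assumes "compact Sm" "Sm \<noteq> {}" "compact Sp" "Sp \<noteq> {}" "Sm \<inter> Sp = {}"
    and D: "D = setdist Sm Sp"
    and \<rho>: "\<And>q. \<rho> q = min (infdist q Sm) (infdist q Sp)"
    and "continuous_on UNIV W" "\<And>q. W q \<ge> 0"
    and "g \<in> borel_measurable (restrict_space borel {0..<D/2})"
    and "\<And>s. s \<in> {0..<D/2} \<Longrightarrow> g s \<ge> 0"
    and "\<And>s. s \<in> {0..<D/2} \<Longrightarrow> \<exists>U. open U \<and> s \<in> U \<and> bounded (g ` (U \<inter> {0..<D/2}))"
    and "\<And>q. \<rho> q < D/2 \<Longrightarrow> W q \<ge> g (\<rho> q)"
    and "\<Psi> \<in> H1_loc" "has_weak_deriv \<Psi> \<Psi>'"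
    and "energy W \<Psi> \<Psi>' < \<infinity>"
    and "\<exists>p\<in>Sm. (cont_rep \<Psi> \<longlongrightarrow> p) at_bot"
    and "\<exists>p\<in>Sp. (cont_rep \<Psi> \<longlongrightarrow> p) at_top"
  shows "energy W \<Psi> \<Psi>' \<ge> 4 * (\<integral>\<^sup>+s\<in>{0..<D/2}. ennreal (sqrt (g s)) \<partial>lborel)
    \<and> ((AE z in lebesgue. \<rho> (\<Psi> z) < D/2 \<longrightarrow> W (\<Psi> z) = g (\<rho> (\<Psi> z)))
       \<and> (AE z in lebesgue. (norm (\<Psi>' z))\<^sup>2 = W (\<Psi> z))
       \<and> (\<exists>r. has_weak_deriv (\<lambda>z. \<rho> (\<Psi> z)) r \<and> (AE z in lebesgue. \<bar>r z\<bar> = norm (\<Psi>' z)))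
       \<and> ((\<lambda>z. \<rho> (cont_rep \<Psi> z)) \<longlongrightarrow> 0) at_bot
       \<and> ((\<lambda>z. \<rho> (cont_rep \<Psi> z)) \<longlongrightarrow> 0) at_top
       \<and> (\<exists>z0. \<rho> (cont_rep \<Psi> z0) = D/2
            \<and> mono_on {..z0} (\<lambda>z. \<rho> (cont_rep \<Psi> z))
            \<and> antimono_on {z0..} (\<lambda>z. \<rho> (cont_rep \<Psi> z)))
       \<and> {z. \<rho> (cont_rep \<Psi> z) = D/2} \<in> null_sets lebesgue
      \<longrightarrow> energy W \<Psi> \<Psi>' = 4 * (\<integral>\<^sup>+s\<in>{0..<D/2}. ennreal (sqrt (g s)) \<partial>lborel))"
proof -
  let ?I = "\<integral>\<^sup>+s\<in>{0..<D/2}. ennreal (sqrt (g s)) \<partial>lborel"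
  obtain w v where w: "continuous_on UNIV w" "AE z in lebesgue. w z = \<Psi> z"
    and vm[measurable]: "v \<in> borel_measurable borel" and v: "AE z in lebesgue. v z = \<Psi>' z"
      "\<And>a b. set_integrable lborel {a..b} v"
    and prim: "\<And>x y. x \<le> y \<Longrightarrow> w y - w x = (LINT t:{x..y}|lborel. v t)"
    by (rule weak_deriv_representation[OF assms(15)]) (rule that)
  have rep: "cont_rep \<Psi> = w" using w by (rule cont_rep_eq)
  define R where "R = (\<lambda>z. \<rho> (w z))"
  have \<rho>_lip: "\<bar>\<rho> p - \<rho> q\<bar> \<le> dist p q" for p q
    using infdist_diff_le[of p Sm q] infdist_diff_le[of p Sp q] unfolding \<rho> min_def by auto
  have \<rho>0: "0 \<le> \<rho> q" for q unfolding \<rho> by (simp add: infdist_nonneg)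
  have \<rho>_cont: "continuous_on UNIV \<rho>"
    unfolding \<rho>[abs_def] by (intro continuous_intros)
  have R: "continuous_on UNIV R"
    unfolding R_def by (rule continuous_on_compose2[OF \<rho>_cont w(1)]) simp
  have lip: "\<bar>R y - R x\<bar> \<le> norm (LINT t:{x..y}|lborel. v t)" if "x \<le> y" for x y
    using \<rho>_lip[of "w y" "w x"] prim[OF that] by (simp add: R_def dist_norm)
  have Ww: "(\<lambda>z. W (w z)) \<in> borel_measurable borel"
    by (intro borel_measurable_continuous_onI continuous_on_compose2[OF assms(8) w(1)]) simp
  \<comment> \<open>\<open>g\<close> is measurable only on \<open>[0, D/2)\<close>; multiplying by
    the indicator extends \<open>sqrt g\<close> by 0 to the whole line.\<close>
  have G: "(\<lambda>s. ennreal (sqrt (g s)) * indicator {0..<D/2} s) \<in> borel_measurable borel"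
  proof -
    have "(\<lambda>s. ennreal (sqrt (g s))) \<in> borel_measurable (restrict_space borel {0..<D/2})"
      using assms(10) by measurable
    then show ?thesis by (subst (asm) borel_measurable_restrict_space_iff_ennreal) auto
  qed
  have energy: "energy W \<Psi> \<Psi>' = (\<integral>\<^sup>+z. ennreal ((norm (v z))\<^sup>2 + W (w z)) \<partial>lborel)"
  proof -
    have "energy W \<Psi> \<Psi>' = (\<integral>\<^sup>+z. ennreal ((norm (v z))\<^sup>2 + W (w z)) \<partial>lebesgue)"
      unfolding energy_def
      by (rule nn_integral_cong_AE) (use w(2) v(1) in \<open>eventually_elim, simp\<close>)
    then show ?thesis by (simp add: nn_integral_completion)
  qed
  obtain p q where p: "p \<in> Sm" "(w \<longlongrightarrow> p) at_bot" and q: "q \<in> Sp" "(w \<longlongrightarrow> q) at_top"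
    using assms(17,18) rep by auto
  have lim: "((\<lambda>z. f (w z)) \<longlongrightarrow> f l) F" if "(w \<longlongrightarrow> l) F" "continuous_on UNIV f" for f :: "'a \<Rightarrow> real" and l F
    using continuous_on_tendsto_compose[OF that(2,1)] by simp
  have \<rho>pq: "\<rho> p = 0" "\<rho> q = 0" using p q unfolding \<rho> by (simp_all add: infdist_nonneg min_absorb1 min_absorb2)
  have bot: "(R \<longlongrightarrow> 0) at_bot" and top: "(R \<longlongrightarrow> 0) at_top"
    using lim[OF p(2) \<rho>_cont] lim[OF q(2) \<rho>_cont] unfolding R_def \<rho>pq .
  have cl: "closed Sm" "closed Sp" using assms(1,3) compact_imp_closed by auto
  \<comment> \<open>At a point equidistant from both wells, both distances are at least \<open>D/2\<close>.\<close>
  obtain z0 where z0: "D/2 \<le> R z0"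
  proof -
    \<comment> \<open>\<open>f\<close> is negative at the limit in \<open>Sm\<close>, which lies
      outside \<open>Sp\<close>, and positive at the limit in \<open>Sp\<close>; a zero along the
      path is an equidistant point.\<close>
    define f where "f = (\<lambda>q. infdist q Sm - infdist q Sp)"
    have fc: "continuous_on UNIV f" unfolding f_def by (intro continuous_intros)
    have notin: "p \<notin> Sp" "q \<notin> Sm" using p q assms(5) by auto
    have "f p < 0" "0 < f q"
      using p q notin cl assms(2,4) infdist_nonneg[of p Sp] infdist_nonneg[of q Sm]
        in_closed_iff_infdist_zero[of Sp p] in_closed_iff_infdist_zero[of Sm q]
      by (auto simp: f_def)
    then have "\<forall>\<^sub>F z in at_bot. f (w z) < 0" "\<forall>\<^sub>F z in at_top. 0 < f (w z)"
      using order_tendstoD(2)[OF lim[OF p(2) fc]] order_tendstoD(1)[OF lim[OF q(2) fc]] by auto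
    then obtain a b where ab: "\<And>z. z \<le> a \<Longrightarrow> f (w z) < 0" "\<And>z. z \<ge> b \<Longrightarrow> 0 < f (w z)"
      unfolding eventually_at_bot_linorder eventually_at_top_linorder by blast
    \<comment> \<open>\<open>max a b\<close>, because the two thresholds come in no particular
      order.\<close>
    have "continuous_on {a..max a b} (\<lambda>z. f (w z))"
      by (rule continuous_on_subset[OF continuous_on_compose2[OF fc w(1)]]) auto
    then have "\<exists>z\<ge>a. z \<le> max a b \<and> f (w z) = 0"
      using ab(1)[of a] ab(2)[of "max a b"] by (intro IVT') auto
    then obtain z where "infdist (w z) Sm = infdist (w z) Sp" unfolding f_def by auto
    with setdist_le_infdist_sum[OF cl(1) assms(2) cl(2) assms(4), of "w z"]
    show ?thesis by (intro that[of z]) (simp add: R_def \<rho> D)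
  qed
  have lower: "4 * ?I \<le> energy W \<Psi> \<Psi>'"
    unfolding energy
    by (rule energy_ge_double_crossing[OF R vm v(2) _ G Ww _ _ _ bot top z0])
      (use lip assms(9,11,13) in \<open>auto simp: R_def\<close>)
  have upper: "energy W \<Psi> \<Psi>' \<le> 4 * ?I"
    if Wg: "AE z in lebesgue. \<rho> (\<Psi> z) < D/2 \<longrightarrow> W (\<Psi> z) = g (\<rho> (\<Psi> z))"
      and eqp: "AE z in lebesgue. (norm (\<Psi>' z))\<^sup>2 = W (\<Psi> z)"
      and r: "has_weak_deriv (\<lambda>z. \<rho> (\<Psi> z)) r" "AE z in lebesgue. \<bar>r z\<bar> = norm (\<Psi>' z)"
      and mono: "R z1 = D/2" "mono_on {..z1} R" "antimono_on {z1..} R"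
      and level: "{z. R z = D/2} \<in> null_sets lebesgue"
    for r z1
  proof -
    obtain w' r0 where w': "continuous_on UNIV w'" "AE z in lebesgue. w' z = \<rho> (\<Psi> z)"
      and r0: "r0 \<in> borel_measurable borel" "AE z in lebesgue. r0 z = r z"
        "\<And>a b. set_integrable lborel {a..b} r0"
        "\<And>x y. x \<le> y \<Longrightarrow> w' y - w' x = (LINT t:{x..y}|lborel. r0 t)"
      by (rule weak_deriv_representation[OF r(1)]) (rule that)
    have "AE z in lebesgue. R z = \<rho> (\<Psi> z)"
      using w(2) by eventually_elim (simp add: R_def)
    \<comment> \<open>Both are continuous and agree a.e. with \<open>\<rho> (\<Psi> z)\<close>, so
      the density \<open>r0\<close> found for \<open>w'\<close> is one for \<open>R\<close>.\<close>
    then have "w' = R" using cont_rep_eq[OF w'] cont_rep_eq[OF R] by simp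
    show ?thesis
      unfolding energy
    proof (rule energy_le_monotone_transition[OF R r0(1,3) _ G _ mono])
      show "R y - R x = (LINT t:{x..y}|lborel. r0 t)" if "x \<le> y" for x y
        using r0(4)[OF that] \<open>w' = R\<close> by simp
      have "AE z in lebesgue. R z < D/2 \<longrightarrow> W (w z) = g (R z)"
        using Wg w(2) by eventually_elim (simp add: R_def)
      then show "AE z in lborel. R z < D/2 \<longrightarrow> W (w z) = g (R z)" by (simp add: AE_completion_iff)
      have "AE z in lebesgue. (norm (v z))\<^sup>2 = W (w z)"
        using eqp w(2) v(1) by eventually_elim simp
      then show "AE z in lborel. (norm (v z))\<^sup>2 = W (w z)" by (simp add: AE_completion_iff)
      have "AE z in lebesgue. \<bar>r0 z\<bar> = norm (v z)"
        using r(2) r0(2) v(1) by eventually_elim simp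
      then show "AE z in lborel. \<bar>r0 z\<bar> = norm (v z)" by (simp add: AE_completion_iff)
      have "AE z in lebesgue. R z \<noteq> D/2"
        using AE_not_in[OF level] by simp
      then show "AE z in lborel. R z \<noteq> D/2" by (simp add: AE_completion_iff)
    qed (use \<rho>0 in \<open>simp add: R_def\<close>)
  qed
  have Rz: "\<rho> (w z) = R z" for z by (simp add: R_def)
  show ?thesis
    unfolding rep Rz
    by (intro conjI impI lower; elim conjE exE; intro antisym[OF _ lower]; rule upper; assumption)
qed

end
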